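(* Under the concept lattice functor (sending a reduced context $\mathbb K$ to $\mathcal B(\mathbb K)$ and a conceptual morphism $(\alpha,\beta)$ to $\alpha^{\rightarrow}=\beta^{\rightarrow}$) and the standard context functor in the reverse direction (sending $L$ to $\mathcal S L=(\mathcal J(L),\mathcal M(L),\le)$ and a morphism $\varphi:L\to L'$ to $(\varphi|_{\mathcal J(L)},\varphi|_{\mathcal M(L)})$), the category of reduced contexts and conceptual morphisms is equivalent to the category of irreducibly bigenerated lattices and complete homomorphisms preserving the least join- and meet-bases. Hence, the conceptual morphisms between reduced contexts are in one-to-one correspondence with the irreducibility preserving complete homomorphisms between their concept lattices.
   Context: **Contexts.** A (formal) context is a triple $\mathbb K=(J,M,I)$ with sets $J,M$ and $I\subseteq J\times M$. For $A\subseteq J$, $A^{\uparrow}=\{m\in M: j\,I\,m\ \forall j\in A\}$; for $B\subseteq M$, $B^{\downarrow}=\{j\in J: j\,I\,m\ \forall m\in B\}$; $j^{\uparrow}=\{j\}^{\uparrow}$, $m^{\downarrow}=\{m\}^{\downarrow}$. Extents are the sets $A$ with $A=A^{\uparrow\downarrow}$, intents the sets $B$ with $B=B^{\downarrow\uparrow}$. A concept is a pair $(A,B)$ with $A=B^{\downarrow}$, $B=A^{\uparrow}$. Ordered by $(A,B)\le(C,D)\iff A\subseteq C$, the concepts form a complete lattice $\mathcal B(\mathbb K)$. Put $\gamma_{\mathbb K}(j)=(j^{\uparrow\downarrow},j^{\uparrow})$, $\mu_{\mathbb K}(m)=(m^{\downarrow},m^{\downarrow\uparrow})$. **Irreducibility.**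 An element $x$ of a complete lattice $L$ is join-irreducible if it is not the join of a set of elements strictly below $x$ (equivalently, it belongs to every join-dense subset; in particular $x$ is not the least element); meet-irreducible is dual. $\mathcal J(L)$, $\mathcal M(L)$ are the sets of join-, resp. meet-irreducible elements. $L$ is irreducibly bigenerated if $\mathcal J(L)$ is join-dense (every element is a join of elements of $\mathcal J(L)$) and $\mathcal M(L)$ is meet-dense in $L$; then these are the least join-base and the least meet-base of $L$. A context $\mathbb K$ is reduced if it is purified ($\gamma_{\mathbb K}$ and $\mu_{\mathbb K}$ are injective), each $\gamma_{\mathbb K}(j)$ is join-irreducible and each $\mu_{\mathbb K}(m)$ is meet-irreducible in $\mathcal B(\mathbb K)$. **Morphisms.** A mapping pair $(\alpha,\beta):\mathbb K=(J,M,I)\to\mathbb L=(H,N,R)$ consists of maps $\alpha:J\to H$, $\beta:M\to N$. It is conceptual if $\alpha$-preimages of extents are extents, $\beta$-preimages of intents are intents, and $(A,B)\in\mathcal B(\mathbb K)$ implies $(\beta[B]^{\downarrow},\alpha[A]^{\uparrow})\in\mathcal B(\mathbb L)$. $\alpha^{\rightarrow}(A,B)=(\alpha[A]^{\uparrow\downarrow},\alpha[A]^{\uparrow})$, $\beta^{\rightarrow}(A,B)=(\beta[B]^{\downarrow},\beta[B]^{\downarrow\uparrow})$. A complete homomorphism $\varphi:L\to L'$ (preserving arbitrary joins and meets) preserves the least bases (is irreducibility preserving) if $\varphi[\mathcal J(L)]\subseteq\mathcal J(L')$ and $\varphi[\mathcal M(L)]\subseteq\mathcal M(L')$. *)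

theory Defs
  imports "HOL-Algebra.Complete_Lattice" "HOL-Library.FuncSet"
begin

section \<open>Formal contexts and concept lattices\<close>

record ('j, 'm) formal_context =
  Objs :: "'j set"
  Atts :: "'m set"
  Inc :: "('j \<times> 'm) set"

definition is_context :: "('j, 'm) formal_context \<Rightarrow> bool" where
  "is_context K \<longleftrightarrow> Inc K \<subseteq> Objs K \<times> Atts K"

definition up :: "('j, 'm) formal_context \<Rightarrow> 'j set \<Rightarrow> 'm set" where
  "up K A = {m \<in> Atts K. \<forall>j\<in>A. (j, m) \<in> Inc K}"

definition down :: "('j, 'm) formal_context \<Rightarrow> 'm set \<Rightarrow> 'j set" where
  "down K B = {j \<in> Objs K. \<forall>m\<in>B. (j, m) \<in> Inc K}"

definition extents :: "('j, 'm) formal_context \<Rightarrow> 'j set set" where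
  "extents K = {A. A \<subseteq> Objs K \<and> A = down K (up K A)}"

definition intents :: "('j, 'm) formal_context \<Rightarrow> 'm set set" where
  "intents K = {B. B \<subseteq> Atts K \<and> B = up K (down K B)}"

type_synonym ('j, 'm) concept = "'j set \<times> 'm set"

definition concepts :: "('j, 'm) formal_context \<Rightarrow> ('j, 'm) concept set" where
  "concepts K = {(A, B). A \<subseteq> Objs K \<and> B \<subseteq> Atts K \<and> A = down K B \<and> B = up K A}"

definition concept_lattice :: "('j, 'm) formal_context \<Rightarrow> ('j, 'm) concept gorder" where
  "concept_lattice K = \<lparr>carrier = concepts K, eq = (=), le = (\<lambda>x y. fst x \<subseteq> fst y)\<rparr>"

definition obj_concept :: "('j, 'm) formal_context \<Rightarrow> 'j \<Rightarrow> ('j, 'm) concept" where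
  "obj_concept K j = (down K (up K {j}), up K {j})"

definition att_concept :: "('j, 'm) formal_context \<Rightarrow> 'm \<Rightarrow> ('j, 'm) concept" where
  "att_concept K m = (down K {m}, up K (down K {m}))"


section \<open>Irreducibility\<close>

definition join_irreducibles :: "'a gorder \<Rightarrow> 'a set" where
  "join_irreducibles L =
     {x \<in> carrier L. \<not> (\<exists>A \<subseteq> {y \<in> carrier L. y \<sqsubset>\<^bsub>L\<^esub> x}. x = \<Squnion>\<^bsub>L\<^esub>A)}"

definition meet_irreducibles :: "'a gorder \<Rightarrow> 'a set" where
  "meet_irreducibles L =
     {x \<in> carrier L. \<not> (\<exists>A \<subseteq> {y \<in> carrier L. x \<sqsubset>\<^bsub>L\<^esub> y}. x = \<Sqinter>\<^bsub>L\<^esub>A)}"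

definition join_dense :: "'a gorder \<Rightarrow> 'a set \<Rightarrow> bool" where
  "join_dense L D \<longleftrightarrow> D \<subseteq> carrier L \<and> (\<forall>x \<in> carrier L. \<exists>A \<subseteq> D. x = \<Squnion>\<^bsub>L\<^esub>A)"

definition meet_dense :: "'a gorder \<Rightarrow> 'a set \<Rightarrow> bool" where
  "meet_dense L D \<longleftrightarrow> D \<subseteq> carrier L \<and> (\<forall>x \<in> carrier L. \<exists>A \<subseteq> D. x = \<Sqinter>\<^bsub>L\<^esub>A)"

definition irreducibly_bigenerated :: "'a gorder \<Rightarrow> bool" where
  "irreducibly_bigenerated L \<longleftrightarrow> complete_lattice L \<and>
     join_dense L (join_irreducibles L) \<and> meet_dense L (meet_irreducibles L)"

definition purified :: "('j, 'm) formal_context \<Rightarrow> bool" where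
  "purified K \<longleftrightarrow> inj_on (obj_concept K) (Objs K) \<and> inj_on (att_concept K) (Atts K)"

definition reduced :: "('j, 'm) formal_context \<Rightarrow> bool" where
  "reduced K \<longleftrightarrow> is_context K \<and> purified K \<and>
     (\<forall>j \<in> Objs K. obj_concept K j \<in> join_irreducibles (concept_lattice K)) \<and>
     (\<forall>m \<in> Atts K. att_concept K m \<in> meet_irreducibles (concept_lattice K))"

definition standard_context :: "'a gorder \<Rightarrow> ('a, 'a) formal_context" where
  "standard_context L = \<lparr>Objs = join_irreducibles L, Atts = meet_irreducibles L,
     Inc = {(j, m). j \<in> join_irreducibles L \<and> m \<in> meet_irreducibles L \<and> j \<sqsubseteq>\<^bsub>L\<^esub> m}\<rparr>"


section \<open>Morphisms\<close>

text \<open>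
  A map between sets \<open>A\<close> and \<open>B\<close> is represented by the unique element of
  \<open>A \<rightarrow>\<^sub>E B\<close> describing it, so that equality of morphisms is equality in HOL.
\<close>

type_synonym ('j, 'm, 'h, 'n) mapping_pair = "('j \<Rightarrow> 'h) \<times> ('m \<Rightarrow> 'n)"

definition conceptual_morphisms ::
    "('j, 'm) formal_context \<Rightarrow> ('h, 'n) formal_context \<Rightarrow> ('j, 'm, 'h, 'n) mapping_pair set" where
  "conceptual_morphisms K L = {(\<alpha>, \<beta>).
     \<alpha> \<in> Objs K \<rightarrow>\<^sub>E Objs L \<and> \<beta> \<in> Atts K \<rightarrow>\<^sub>E Atts L \<and>
     (\<forall>A \<in> extents L. \<alpha> -` A \<inter> Objs K \<in> extents K) \<and>
     (\<forall>B \<in> intents L. \<beta> -` B \<inter> Atts K \<in> intents K) \<and>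
     (\<forall>(A, B) \<in> concepts K. (down L (\<beta> ` B), up L (\<alpha> ` A)) \<in> concepts L)}"

definition context_id :: "('j, 'm) formal_context \<Rightarrow> ('j, 'm, 'j, 'm) mapping_pair" where
  "context_id K = (restrict id (Objs K), restrict id (Atts K))"

definition context_comp :: "('j, 'm) formal_context \<Rightarrow> ('h, 'n, 'p, 'q) mapping_pair \<Rightarrow>
    ('j, 'm, 'h, 'n) mapping_pair \<Rightarrow> ('j, 'm, 'p, 'q) mapping_pair" where
  "context_comp K g f = (compose (Objs K) (fst g) (fst f), compose (Atts K) (snd g) (snd f))"

definition context_isos ::
    "('j, 'm) formal_context \<Rightarrow> ('h, 'n) formal_context \<Rightarrow> ('j, 'm, 'h, 'n) mapping_pair set" where
  "context_isos K L = {f \<in> conceptual_morphisms K L. \<exists>g \<in> conceptual_morphisms L K.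
     context_comp K g f = context_id K \<and> context_comp L f g = context_id L}"

definition complete_homs :: "'a gorder \<Rightarrow> 'b gorder \<Rightarrow> ('a \<Rightarrow> 'b) set" where
  "complete_homs L L' = {\<phi> \<in> carrier L \<rightarrow>\<^sub>E carrier L'.
     sup_pres L L' \<phi> \<and> inf_pres L L' \<phi>}"

definition irr_preserving_homs :: "'a gorder \<Rightarrow> 'b gorder \<Rightarrow> ('a \<Rightarrow> 'b) set" where
  "irr_preserving_homs L L' = {\<phi> \<in> complete_homs L L'.
     \<phi> ` join_irreducibles L \<subseteq> join_irreducibles L' \<and>
     \<phi> ` meet_irreducibles L \<subseteq> meet_irreducibles L'}"

definition lattice_id :: "'a gorder \<Rightarrow> 'a \<Rightarrow> 'a" where
  "lattice_id L = restrict id (carrier L)"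

definition lattice_comp :: "'a gorder \<Rightarrow> ('b \<Rightarrow> 'c) \<Rightarrow> ('a \<Rightarrow> 'b) \<Rightarrow> 'a \<Rightarrow> 'c" where
  "lattice_comp L \<psi> \<phi> = compose (carrier L) \<psi> \<phi>"

definition lattice_isos :: "'a gorder \<Rightarrow> 'b gorder \<Rightarrow> ('a \<Rightarrow> 'b) set" where
  "lattice_isos L L' = {\<phi> \<in> irr_preserving_homs L L'. \<exists>\<psi> \<in> irr_preserving_homs L' L.
     lattice_comp L \<psi> \<phi> = lattice_id L \<and> lattice_comp L' \<phi> \<psi> = lattice_id L'}"

definition obj_lift :: "('j, 'm) formal_context \<Rightarrow> ('h, 'n) formal_context \<Rightarrow>
    ('j, 'm, 'h, 'n) mapping_pair \<Rightarrow> ('j, 'm) concept \<Rightarrow> ('h, 'n) concept" where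
  "obj_lift K L f =
     (\<lambda>(A, B) \<in> concepts K. (down L (up L (fst f ` A)), up L (fst f ` A)))"

definition att_lift :: "('j, 'm) formal_context \<Rightarrow> ('h, 'n) formal_context \<Rightarrow>
    ('j, 'm, 'h, 'n) mapping_pair \<Rightarrow> ('j, 'm) concept \<Rightarrow> ('h, 'n) concept" where
  "att_lift K L f =
     (\<lambda>(A, B) \<in> concepts K. (down L (snd f ` B), up L (down L (snd f ` B))))"

definition standard_restrict :: "'a gorder \<Rightarrow> ('a \<Rightarrow> 'b) \<Rightarrow> ('a, 'a, 'b, 'b) mapping_pair" where
  "standard_restrict L \<phi> = (restrict \<phi> (join_irreducibles L), restrict \<phi> (meet_irreducibles L))"

text \<open>The components of the two natural isomorphisms.\<close>

definition context_unit ::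
    "('j, 'm) formal_context \<Rightarrow> ('j, 'm, ('j, 'm) concept, ('j, 'm) concept) mapping_pair" where
  "context_unit K = (restrict (obj_concept K) (Objs K), restrict (att_concept K) (Atts K))"

definition lattice_unit :: "'a gorder \<Rightarrow> 'a \<Rightarrow> ('a, 'a) concept" where
  "lattice_unit L = (\<lambda>x \<in> carrier L.
     ({j \<in> join_irreducibles L. j \<sqsubseteq>\<^bsub>L\<^esub> x}, {m \<in> meet_irreducibles L. x \<sqsubseteq>\<^bsub>L\<^esub> m}))"


section \<open>Categories, functors, equivalences\<close>

text \<open>
  \<open>Comp C X Y Z g f\<close> is the composite of \<open>f\<close> from \<open>X\<close> to \<open>Y\<close> with \<open>g\<close> from \<open>Y\<close> to \<open>Z\<close>.
  Hom-sets need not be disjoint, hence everything acting on arrows is indexed by objects.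
\<close>

record ('o, 'a) cat =
  Ob :: "'o set"
  Hom :: "'o \<Rightarrow> 'o \<Rightarrow> 'a set"
  Id :: "'o \<Rightarrow> 'a"
  Comp :: "'o \<Rightarrow> 'o \<Rightarrow> 'o \<Rightarrow> 'a \<Rightarrow> 'a \<Rightarrow> 'a"

definition is_category :: "('o, 'a) cat \<Rightarrow> bool" where
  "is_category C \<longleftrightarrow>
     (\<forall>X \<in> Ob C. Id C X \<in> Hom C X X) \<and>
     (\<forall>X \<in> Ob C. \<forall>Y \<in> Ob C. \<forall>Z \<in> Ob C. \<forall>f \<in> Hom C X Y. \<forall>g \<in> Hom C Y Z.
        Comp C X Y Z g f \<in> Hom C X Z) \<and>
     (\<forall>X \<in> Ob C. \<forall>Y \<in> Ob C. \<forall>f \<in> Hom C X Y.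
        Comp C X X Y f (Id C X) = f \<and> Comp C X Y Y (Id C Y) f = f) \<and>
     (\<forall>W \<in> Ob C. \<forall>X \<in> Ob C. \<forall>Y \<in> Ob C. \<forall>Z \<in> Ob C.
        \<forall>f \<in> Hom C W X. \<forall>g \<in> Hom C X Y. \<forall>h \<in> Hom C Y Z.
        Comp C W X Z (Comp C X Y Z h g) f = Comp C W Y Z h (Comp C W X Y g f))"

record ('o, 'a, 'p, 'b) ftor =
  on_ob :: "'o \<Rightarrow> 'p"
  on_hom :: "'o \<Rightarrow> 'o \<Rightarrow> 'a \<Rightarrow> 'b"

definition is_functor :: "('o, 'a) cat \<Rightarrow> ('p, 'b) cat \<Rightarrow> ('o, 'a, 'p, 'b) ftor \<Rightarrow> bool" where
  "is_functor C D F \<longleftrightarrow> is_category C \<and> is_category D \<and>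
     (\<forall>X \<in> Ob C. on_ob F X \<in> Ob D) \<and>
     (\<forall>X \<in> Ob C. \<forall>Y \<in> Ob C. \<forall>f \<in> Hom C X Y.
        on_hom F X Y f \<in> Hom D (on_ob F X) (on_ob F Y)) \<and>
     (\<forall>X \<in> Ob C. on_hom F X X (Id C X) = Id D (on_ob F X)) \<and>
     (\<forall>X \<in> Ob C. \<forall>Y \<in> Ob C. \<forall>Z \<in> Ob C. \<forall>f \<in> Hom C X Y. \<forall>g \<in> Hom C Y Z.
        on_hom F X Z (Comp C X Y Z g f) =
        Comp D (on_ob F X) (on_ob F Y) (on_ob F Z) (on_hom F Y Z g) (on_hom F X Y f))"

definition id_functor :: "('o, 'a, 'o, 'a) ftor" where
  "id_functor = \<lparr>on_ob = (\<lambda>X. X), on_hom = (\<lambda>X Y f. f)\<rparr>"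

definition comp_functor ::
    "('p, 'b, 'q, 'c) ftor \<Rightarrow> ('o, 'a, 'p, 'b) ftor \<Rightarrow> ('o, 'a, 'q, 'c) ftor" where
  "comp_functor G F = \<lparr>on_ob = (\<lambda>X. on_ob G (on_ob F X)),
     on_hom = (\<lambda>X Y f. on_hom G (on_ob F X) (on_ob F Y) (on_hom F X Y f))\<rparr>"

definition isos :: "('o, 'a) cat \<Rightarrow> 'o \<Rightarrow> 'o \<Rightarrow> 'a set" where
  "isos C X Y = {f \<in> Hom C X Y. \<exists>g \<in> Hom C Y X.
     Comp C X Y X g f = Id C X \<and> Comp C Y X Y f g = Id C Y}"

definition natural_isomorphism :: "('o, 'a) cat \<Rightarrow> ('p, 'b) cat \<Rightarrow>
    ('o, 'a, 'p, 'b) ftor \<Rightarrow> ('o, 'a, 'p, 'b) ftor \<Rightarrow> ('o \<Rightarrow> 'b) \<Rightarrow> bool" where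
  "natural_isomorphism C D F G \<eta> \<longleftrightarrow> is_functor C D F \<and> is_functor C D G \<and>
     (\<forall>X \<in> Ob C. \<eta> X \<in> isos D (on_ob F X) (on_ob G X)) \<and>
     (\<forall>X \<in> Ob C. \<forall>Y \<in> Ob C. \<forall>f \<in> Hom C X Y.
        Comp D (on_ob F X) (on_ob F Y) (on_ob G Y) (\<eta> Y) (on_hom F X Y f) =
        Comp D (on_ob F X) (on_ob G X) (on_ob G Y) (on_hom G X Y f) (\<eta> X))"

definition equivalence_of_categories :: "('o, 'a) cat \<Rightarrow> ('p, 'b) cat \<Rightarrow>
    ('o, 'a, 'p, 'b) ftor \<Rightarrow> ('p, 'b, 'o, 'a) ftor \<Rightarrow> bool" where
  "equivalence_of_categories C D F G \<longleftrightarrow> is_functor C D F \<and> is_functor D C G \<and>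
     (\<exists>\<eta>. natural_isomorphism C C id_functor (comp_functor G F) \<eta>) \<and>
     (\<exists>\<epsilon>. natural_isomorphism D D (comp_functor F G) id_functor \<epsilon>)"


section \<open>The two categories over a universe\<close>

text \<open>
  A category in HOL has its objects in one type, but the concepts of a context over \<open>'u\<close> live in
  \<open>'u set \<times> 'u set\<close>. As usual in category theory we therefore fix a universe: a notion of
  smallness for subsets of \<open>'u\<close>, together with an encoding of pairs of small sets as elements of
  \<open>'u\<close>. The small sets of a Grothendieck universe form an instance; by the lemma
  \<open>universe_exists\<close> below, so do the sets of size at most \<open>\<kappa>\<close>, for every infinite cardinal
  \<open>\<kappa>\<close> represented by a HOL type.
\<close>

definition universe :: "('u set \<Rightarrow> bool) \<Rightarrow> ('u set \<times> 'u set \<Rightarrow> 'u) \<Rightarrow> bool" where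
  "universe small enc \<longleftrightarrow>
     small {} \<and>
     (\<forall>A B. small A \<and> B \<subseteq> A \<longrightarrow> small B) \<and>
     (\<forall>A f. small A \<longrightarrow> small (f ` A)) \<and>
     inj_on enc {(A, B). small A \<and> small B}"

definition reduced_contexts ::
    "('u set \<Rightarrow> bool) \<Rightarrow> (('u, 'u) formal_context, ('u, 'u, 'u, 'u) mapping_pair) cat" where
  "reduced_contexts small =
     \<lparr>Ob = {K. reduced K \<and> small (Objs K) \<and> small (Atts K)},
      Hom = conceptual_morphisms,
      Id = context_id,
      Comp = (\<lambda>K L M. context_comp K)\<rparr>"

text \<open>
  A lattice belongs to the universe if its least join-base and its least meet-base do. (If the
  small sets are closed under powersets, this amounts to smallness of the carrier.)
\<close>

definition bigenerated_lattices :: "('u set \<Rightarrow> bool) \<Rightarrow> ('u gorder, 'u \<Rightarrow> 'u) cat" where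
  "bigenerated_lattices small =
     \<lparr>Ob = {L. irreducibly_bigenerated L \<and>
               small (join_irreducibles L) \<and> small (meet_irreducibles L)},
      Hom = irr_preserving_homs,
      Id = lattice_id,
      Comp = (\<lambda>L L' L''. lattice_comp L)\<rparr>"

text \<open>The concept lattice functor, where concepts are replaced by their codes in \<open>'u\<close>.\<close>

definition encoded_concept_lattice ::
    "('u set \<times> 'u set \<Rightarrow> 'u) \<Rightarrow> ('u, 'u) formal_context \<Rightarrow> 'u gorder" where
  "encoded_concept_lattice enc K =
     \<lparr>carrier = enc ` concepts K, eq = (=),
      le = (\<lambda>x y. inv_into (concepts K) enc x \<sqsubseteq>\<^bsub>concept_lattice K\<^esub> inv_into (concepts K) enc y)\<rparr>"

definition concept_lattice_functor :: "('u set \<times> 'u set \<Rightarrow> 'u) \<Rightarrow>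
    (('u, 'u) formal_context, ('u, 'u, 'u, 'u) mapping_pair, 'u gorder, 'u \<Rightarrow> 'u) ftor" where
  "concept_lattice_functor enc =
     \<lparr>on_ob = encoded_concept_lattice enc,
      on_hom = (\<lambda>K L f. \<lambda>x \<in> enc ` concepts K. enc (obj_lift K L f (inv_into (concepts K) enc x)))\<rparr>"

definition standard_context_functor ::
    "('u gorder, 'u \<Rightarrow> 'u, ('u, 'u) formal_context, ('u, 'u, 'u, 'u) mapping_pair) ftor" where
  "standard_context_functor =
     \<lparr>on_ob = standard_context, on_hom = (\<lambda>L L'. standard_restrict L)\<rparr>"

lemma universe_exists:
  assumes "infinite (UNIV :: 'k set)"
  shows "\<exists>enc. universe (\<lambda>A :: 'k set set. \<exists>f :: 'k \<Rightarrow> 'k set. A \<subseteq> range f) enc"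
proof -
  let ?small = "\<lambda>A :: 'k set set. \<exists>f :: 'k \<Rightarrow> 'k set. A \<subseteq> range f"
  have "\<exists>f. bij_betw f ((UNIV :: 'k set) \<times> (UNIV :: 'k set)) (UNIV :: 'k set)"
    using card_of_Times_same_infinite[OF assms] card_of_ordIso by blast
  then obtain p :: "'k \<times> 'k \<Rightarrow> 'k" where p: "inj p"
    by (auto simp: bij_betw_def)
  obtain a b :: 'k where ab: "a \<noteq> b"
    using infinite_arbitrarily_large[OF assms, of 2] by (auto simp: card_2_iff)
  define P where "P = (\<lambda>X Y :: 'k set. (\<lambda>x. p (a, x)) ` X \<union> (\<lambda>y. p (b, y)) ` Y)"
  have P: "X = X' \<and> Y = Y'" if "P X Y = P X' Y'" for X Y X' Y'
  proof -
    have *: "X = {x. p (a, x) \<in> P X Y}" "Y = {y. p (b, y) \<in> P X Y}" for X Y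
      using ab by (auto simp: P_def inj_eq[OF p])
    have "X = X'" using *(1)[of X Y] *(1)[of X' Y'] unfolding that by (rule trans[OF _ sym])
    moreover have "Y = Y'" using *(2)[where X = X and Y = Y] *(2)[where X = X' and Y = Y']
      unfolding that by (rule trans[OF _ sym])
    ultimately show ?thesis ..
  qed
  define F where "F = (\<lambda>A. SOME f :: 'k \<Rightarrow> 'k set. A \<subseteq> range f)"
  define E where "E = (\<lambda>A. P (F A -` A) {p (k, i) |k i. i \<in> F A k})"
  have E: "A = A'" if s: "?small A" "?small A'" and e: "E A = E A'" for A A'
  proof -
    have F: "F A -` A = F A' -` A'"
      and G: "{p (k, i) |k i. i \<in> F A k} = {p (k, i) |k i. i \<in> F A' k}"
      by (rule conjunct1[OF P[OF e[unfolded E_def]]], rule conjunct2[OF P[OF e[unfolded E_def]]])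
    have *: "F A k = {i. p (k, i) \<in> {p (k, i) |k i. i \<in> F A k}}" for A k
      by (auto simp: inj_eq[OF p])
    have FF: "F A = F A'"
    proof
      show "F A k = F A' k" for k
        using *[of A k] *[of A' k] unfolding G by (rule trans[OF _ sym])
    qed
    have *: "B = F B ` (F B -` B)" if "?small B" for B
    proof -
      have "B \<subseteq> range (F B)" unfolding F_def using someI_ex[OF that] .
      then show ?thesis by auto
    qed
    have "A = F A ` (F A -` A)" "A' = F A' ` (F A' -` A')" by (rule *[OF s(1)], rule *[OF s(2)])
    moreover have "F A ` (F A -` A) = F A' ` (F A' -` A')" by (simp only: F) (simp only: FF)
    ultimately show ?thesis by argo
  qed
  have "inj_on (\<lambda>(A, B). P (E A) (E B)) {(A, B). ?small A \<and> ?small B}"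
  proof (rule inj_onI)
    fix u v
    assume "u \<in> {(A, B). ?small A \<and> ?small B}" "v \<in> {(A, B). ?small A \<and> ?small B}"
    then have u: "?small (fst u)" "?small (snd u)" and v: "?small (fst v)" "?small (snd v)"
      by (simp_all only: mem_Collect_eq split_beta)
    assume "(\<lambda>(A, B). P (E A) (E B)) u = (\<lambda>(A, B). P (E A) (E B)) v"
    then have "E (fst u) = E (fst v) \<and> E (snd u) = E (snd v)"
      unfolding split_beta by (rule P)
    then show "u = v" using E[OF u(1) v(1)] E[OF u(2) v(2)] by (simp add: prod_eq_iff)
  qed
  moreover have "\<forall>A (g :: 'k set \<Rightarrow> 'k set). ?small A \<longrightarrow> ?small (g ` A)"
  proof (intro allI impI)
    fix A and g :: "'k set \<Rightarrow> 'k set"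
    assume "?small A"
    then obtain f :: "'k \<Rightarrow> 'k set" where "A \<subseteq> range f" by blast
    then have "g ` A \<subseteq> range (g \<circ> f)" by auto
    then show "?small (g ` A)" by blast
  qed
  moreover have "?small {}" by simp
  moreover have "\<forall>A B. ?small A \<and> B \<subseteq> A \<longrightarrow> ?small B"
    by (meson order_trans)
  ultimately have "universe ?small (\<lambda>(A, B). P (E A) (E B))"
    unfolding universe_def by (intro conjI)
  then show ?thesis by blast
qed

end

theory Submission
  imports Defs
begin

text \<open>
  Say that a context \<open>K\<close> represents a lattice \<open>L\<close> if maps \<open>\<gamma>\<close>, \<open>\<mu>\<close> index the dense sets of join- and
  meet-irreducible elements by objects and attributes, incidence being the order. Then every
  element of \<open>L\<close> is a concept of \<open>K\<close>, and a mapping pair \<open>(\<alpha>, \<beta>)\<close> and a homomorphism \<open>\<phi>\<close> correspond if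
  \<open>\<phi> \<circ> \<gamma> = \<gamma>' \<circ> \<alpha>\<close> and \<open>\<phi> \<circ> \<mu> = \<mu>' \<circ> \<beta>\<close>. Preimages of extents being extents amounts to \<open>\<phi>\<close> having
  an upper adjoint, that is, to preservation of joins; dually for meets. So this correspondence is
  a bijection between conceptual morphisms and irreducibility preserving complete homomorphisms.
  It is compatible with composition and does not depend on the chosen representations, so
  functoriality, naturality and invertibility of the units all follow from uniqueness.
\<close>

section \<open>Joins and meets\<close>

text \<open>The conditions on a conceptual pair divide the work. Given the preimage conditions,
  \<open>\<alpha>\<close> alone yields a join-preserving map, sending x to the join of
  \<open>\<gamma>' (\<alpha> j)\<close> over the objects j below x, and \<open>\<beta>\<close> alone
  yields a meet-preserving one. The remaining condition says that the two maps coincide: the concept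
  it demands has the extent of the second value and the intent of the first. The obstacle is
  composition. The image of an intent need not be an intent, so the concept condition cannot simply
  be iterated. Composites are therefore handled through the associated homomorphisms, and
  reducedness enters already in the proof that contexts form a category. All notions are symmetric
  under reversing the order and exchanging objects with attributes, so most statements about meets
  are read off from those about joins.\<close>

context complete_lattice
begin

lemma sup_le_iff:
  assumes "A \<subseteq> carrier L" "y \<in> carrier L"
  shows "\<Squnion>A \<sqsubseteq> y \<longleftrightarrow> (\<forall>a\<in>A. a \<sqsubseteq> y)"
  using assms by (meson le_trans subsetD sup_closed sup_least sup_upper)

text \<open>Joins are accessible through their upper bounds (\<open>sup_le_iff\<close>), so
  equations between joins are proved by comparing upper bounds instead of by two
  inequalities.\<close>

lemma eq_if_same_upper:
  assumes "x \<in> carrier L" "y \<in> carrier L" "\<And>z. z \<in> carrier L \<Longrightarrow> x \<sqsubseteq> z \<longleftrightarrow> y \<sqsubseteq> z"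
  shows "x = y"
  using assms by (metis le_refl le_antisym)

lemma complete_lattice_dual: "complete_lattice (inv_gorder L)"
proof -
  interpret dual: partial_order "inv_gorder L"
    by (rule dual_order)
  show ?thesis
    by unfold_locales (simp_all add: inf_exists sup_exists)
qed

lemma least_iff:
  assumes "A \<subseteq> carrier L"
  shows "least L s (Upper L A) \<longleftrightarrow> s = \<Squnion>A"
  using assms by (meson least_unique sup_lub)

lemma greatest_iff:
  assumes "A \<subseteq> carrier L"
  shows "greatest L s (Lower L A) \<longleftrightarrow> s = \<Sqinter>A"
  using assms by (meson greatest_unique inf_glb)

end

lemma meet_irreducibles_dual:
  assumes "complete_lattice L"
  shows "meet_irreducibles (inv_gorder L) = join_irreducibles L"
proof -
  interpret complete_lattice L by (rule assms)
  show ?thesis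
    unfolding join_irreducibles_def meet_irreducibles_def lless_def inf_dual
    by (simp add: eq_is_equal eq_commute)
qed

lemma join_irreducibles_dual:
  assumes "complete_lattice L"
  shows "join_irreducibles (inv_gorder L) = meet_irreducibles L"
proof -
  interpret complete_lattice L by (rule assms)
  show ?thesis
    unfolding join_irreducibles_def meet_irreducibles_def lless_def sup_dual
    by (simp add: eq_is_equal eq_commute)
qed

lemma join_dense_dual: "join_dense (inv_gorder L) D = meet_dense L D"
  by (simp add: join_dense_def meet_dense_def)

lemma meet_dense_dual: "meet_dense (inv_gorder L) D = join_dense L D"
  by (simp add: join_dense_def meet_dense_def)


section \<open>Order isomorphisms\<close>

text \<open>Only the source is assumed complete; the target inherits this. The condition
  \<open>eq\<close> is separate because a \<open>gorder\<close> carries its own equivalence, which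
  the order relation does not determine.\<close>

locale lattice_iso = L: complete_lattice L for L :: "'a gorder" +
  fixes L' :: "'b gorder" and h :: "'a \<Rightarrow> 'b"
  assumes bij: "bij_betw h (carrier L) (carrier L')"
    and le_iff: "\<lbrakk>x \<in> carrier L; y \<in> carrier L\<rbrakk> \<Longrightarrow> h x \<sqsubseteq>\<^bsub>L'\<^esub> h y \<longleftrightarrow> x \<sqsubseteq>\<^bsub>L\<^esub> y"
    and eq: "(.=\<^bsub>L'\<^esub>) = (=)"
begin

lemma carrier_image: "carrier L' = h ` carrier L"
  using bij by (simp add: bij_betw_def)

lemma inj: "x \<in> carrier L \<Longrightarrow> y \<in> carrier L \<Longrightarrow> h x = h y \<longleftrightarrow> x = y"
  using bij by (auto simp: bij_betw_def inj_on_def)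

text \<open>Phrased as a least upper bound rather than as an equation between joins, because
  completeness of \<open>L'\<close> is derived from this very existence statement.\<close>

lemma sup_image_least:
  assumes "B \<subseteq> carrier L"
  shows "least L' (h (\<Squnion>\<^bsub>L\<^esub>B)) (Upper L' (h ` B))"
proof (rule least_UpperI)
  show "h ` B \<subseteq> carrier L'" "h (\<Squnion>\<^bsub>L\<^esub>B) \<in> carrier L'"
    using assms by (auto simp: carrier_image)
  show "x \<sqsubseteq>\<^bsub>L'\<^esub> h (\<Squnion>\<^bsub>L\<^esub>B)" if x: "x \<in> h ` B" for x
  proof -
    obtain b where "b \<in> B" "x = h b"
      using x by blast
    then show ?thesis
      using L.sup_upper[OF assms, of b] assms by (simp add: le_iff subsetD)
  qed
  show "h (\<Squnion>\<^bsub>L\<^esub>B) \<sqsubseteq>\<^bsub>L'\<^esub> y" if "y \<in> Upper L' (h ` B)" for y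
  proof -
    have "y \<in> carrier L'" and y: "\<And>b. b \<in> B \<Longrightarrow> h b \<sqsubseteq>\<^bsub>L'\<^esub> y"
      using that assms by (auto simp: Upper_def carrier_image)
    then obtain z where z: "z \<in> carrier L" "y = h z"
      unfolding carrier_image by (elim imageE)
    have "b \<sqsubseteq>\<^bsub>L\<^esub> z" if "b \<in> B" for b
      using y[OF that] that z assms le_iff[of b z] by (simp add: subsetD)
    then show ?thesis
      using z assms by (simp add: le_iff L.sup_le_iff)
  qed
qed

lemma partial_order_target: "partial_order L'"
proof unfold_locales
  fix x y z
  assume "x \<in> carrier L'" "y \<in> carrier L'" "z \<in> carrier L'"
  then obtain a b c where
    "a \<in> carrier L" "x = h a" "b \<in> carrier L" "y = h b" "c \<in> carrier L" "z = h c"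
    by (auto simp: carrier_image)
  then show "x \<sqsubseteq>\<^bsub>L'\<^esub> y \<Longrightarrow> y \<sqsubseteq>\<^bsub>L'\<^esub> z \<Longrightarrow> x \<sqsubseteq>\<^bsub>L'\<^esub> z"
    and "x \<sqsubseteq>\<^bsub>L'\<^esub> y \<Longrightarrow> y \<sqsubseteq>\<^bsub>L'\<^esub> x \<Longrightarrow> x .=\<^bsub>L'\<^esub> y"
    using L.le_trans[of a b c] L.le_antisym[of a b] by (simp_all add: le_iff eq)
qed (auto simp: eq carrier_image le_iff)

lemma dual: "lattice_iso (inv_gorder L) (inv_gorder L') h"
proof -
  interpret dual: complete_lattice "inv_gorder L"
    by (rule L.complete_lattice_dual)
  show ?thesis
    by unfold_locales (simp_all add: bij le_iff eq)
qed

lemma inf_image_greatest: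
  assumes "B \<subseteq> carrier L"
  shows "greatest L' (h (\<Sqinter>\<^bsub>L\<^esub>B)) (Lower L' (h ` B))"
  using lattice_iso.sup_image_least[OF dual, of B] assms by simp

lemma complete_lattice_target: "complete_lattice L'"
proof -
  interpret L': partial_order L'
    by (rule partial_order_target)
  show ?thesis
  proof (rule L'.complete_latticeI)
    fix A
    assume "A \<subseteq> carrier L'"
    then obtain B where "B \<subseteq> carrier L" "A = h ` B"
      unfolding carrier_image by (auto simp: subset_image_iff)
    then show "\<exists>s. is_lub L' s A" "\<exists>i. is_glb L' i A"
      using sup_image_least inf_image_greatest by auto
  qed
qed

sublocale L': complete_lattice L'
  by (rule complete_lattice_target)

lemma image_sup: "B \<subseteq> carrier L \<Longrightarrow> h (\<Squnion>\<^bsub>L\<^esub>B) = \<Squnion>\<^bsub>L'\<^esub>(h ` B)"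
  using sup_image_least by (intro L'.least_iff[THEN iffD1]) (auto simp: carrier_image)

lemma image_inf: "B \<subseteq> carrier L \<Longrightarrow> h (\<Sqinter>\<^bsub>L\<^esub>B) = \<Sqinter>\<^bsub>L'\<^esub>(h ` B)"
  using inf_image_greatest by (intro L'.greatest_iff[THEN iffD1]) (auto simp: carrier_image)

lemma inverse: "lattice_iso L' L (inv_into (carrier L) h)"
proof unfold_locales
  show "bij_betw (inv_into (carrier L) h) (carrier L') (carrier L)"
    by (rule bij_betw_inv_into[OF bij])
  fix x y
  assume "x \<in> carrier L'" "y \<in> carrier L'"
  then show "inv_into (carrier L) h x \<sqsubseteq>\<^bsub>L\<^esub> inv_into (carrier L) h y \<longleftrightarrow> x \<sqsubseteq>\<^bsub>L'\<^esub> y"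
    using le_iff[of "inv_into (carrier L) h x" "inv_into (carrier L) h y"]
    by (simp add: carrier_image inv_into_into f_inv_into_f)
qed (rule L.eq_is_equal)

text \<open>A decomposition of \<open>x\<close> into strictly smaller elements would be carried to
  one of \<open>h x\<close>. Applied to the inverse isomorphism as well, this gives the
  equivalence.\<close>

lemma image_join_irreducible:
  assumes "h x \<in> join_irreducibles L'" "x \<in> carrier L"
  shows "x \<in> join_irreducibles L"
proof -
  have "h x = \<Squnion>\<^bsub>L'\<^esub>(h ` A) \<and> h ` A \<subseteq> {y \<in> carrier L'. y \<sqsubset>\<^bsub>L'\<^esub> h x}"
    if "A \<subseteq> {y \<in> carrier L. y \<sqsubset>\<^bsub>L\<^esub> x}" "x = \<Squnion>\<^bsub>L\<^esub>A" for A
  proof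
    show "h x = \<Squnion>\<^bsub>L'\<^esub>(h ` A)"
      using image_sup[of A] that by auto
    show "h ` A \<subseteq> {y \<in> carrier L'. y \<sqsubset>\<^bsub>L'\<^esub> h x}"
      using that(1) assms(2)
      by (auto simp: lless_def eq L.eq_is_equal carrier_image le_iff inj)
  qed
  then show ?thesis
    using assms unfolding join_irreducibles_def by blast
qed

lemma inv_image: "x \<in> carrier L \<Longrightarrow> inv_into (carrier L) h (h x) = x"
  using bij by (simp add: bij_betw_def inv_into_f_f)

lemma image_join_irreducible_iff:
  "x \<in> carrier L \<Longrightarrow> h x \<in> join_irreducibles L' \<longleftrightarrow> x \<in> join_irreducibles L"
  using image_join_irreducible lattice_iso.image_join_irreducible[OF inverse, of "h x"]
  by (auto simp: inv_image carrier_image)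

lemma image_join_irreducibles: "h ` join_irreducibles L = join_irreducibles L'"
proof -
  have "join_irreducibles L \<subseteq> carrier L" "join_irreducibles L' \<subseteq> h ` carrier L"
    by (auto simp: join_irreducibles_def carrier_image)
  then show ?thesis
    using image_join_irreducible_iff by blast
qed

lemma image_meet_irreducibles: "h ` meet_irreducibles L = meet_irreducibles L'"
  using lattice_iso.image_join_irreducibles[OF dual]
  by (simp add: join_irreducibles_dual[OF L.complete_lattice_axioms]
      join_irreducibles_dual[OF L'.complete_lattice_axioms])

lemma image_join_dense:
  assumes "join_dense L D"
  shows "join_dense L' (h ` D)"
  unfolding join_dense_def
proof (intro conjI ballI)
  have D: "D \<subseteq> carrier L"
    using assms by (simp add: join_dense_def)
  then show "h ` D \<subseteq> carrier L'"
    by (auto simp: carrier_image)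
  fix y
  assume "y \<in> carrier L'"
  then obtain x where "x \<in> carrier L" "y = h x"
    by (auto simp: carrier_image)
  moreover from this obtain A where "A \<subseteq> D" "x = \<Squnion>\<^bsub>L\<^esub>A"
    using assms by (auto simp: join_dense_def)
  ultimately show "\<exists>A\<subseteq>h ` D. y = \<Squnion>\<^bsub>L'\<^esub>A"
    using D image_sup[of A] by (intro exI[of _ "h ` A"]) auto
qed

lemma image_meet_dense: "meet_dense L D \<Longrightarrow> meet_dense L' (h ` D)"
  using lattice_iso.image_join_dense[OF dual, of D] by (simp add: join_dense_dual)

lemma restrict_irr_preserving: "restrict h (carrier L) \<in> irr_preserving_homs L L'"
proof -
  \<comment> \<open>Morphisms are extensional, so \<open>h\<close> is cut down to the carrier;
    images of subsets of the carrier are unaffected.\<close>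
  have *: "restrict h (carrier L) ` A = h ` A" if "A \<subseteq> carrier L" for A
    using that by (intro image_cong) auto
  have "join_irreducibles L \<subseteq> carrier L" "meet_irreducibles L \<subseteq> carrier L"
    by (auto simp: join_irreducibles_def meet_irreducibles_def)
  then have "restrict h (carrier L) ` join_irreducibles L = join_irreducibles L'"
    "restrict h (carrier L) ` meet_irreducibles L = meet_irreducibles L'"
    using image_join_irreducibles image_meet_irreducibles by (simp_all only: *)
  moreover have "restrict h (carrier L) (\<Squnion>\<^bsub>L\<^esub>A) = \<Squnion>\<^bsub>L'\<^esub>(restrict h (carrier L) ` A)"
    "restrict h (carrier L) (\<Sqinter>\<^bsub>L\<^esub>A) = \<Sqinter>\<^bsub>L'\<^esub>(restrict h (carrier L) ` A)"
    if "A \<subseteq> carrier L" for A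
    using that unfolding *[OF that] by (simp_all add: image_sup image_inf)
  ultimately show ?thesis
    unfolding irr_preserving_homs_def complete_homs_def sup_pres_def inf_pres_def
    using L.complete_lattice_axioms L'.complete_lattice_axioms by (simp add: carrier_image)
qed

lemma restrict_lattice_iso: "restrict h (carrier L) \<in> lattice_isos L L'"
proof -
  let ?h = "restrict h (carrier L)" and ?i = "restrict (inv_into (carrier L) h) (carrier L')"
  have "?i \<in> irr_preserving_homs L' L"
    by (rule lattice_iso.restrict_irr_preserving[OF inverse])
  moreover have "lattice_comp L ?i ?h = lattice_id L"
    unfolding lattice_comp_def lattice_id_def compose_def
    by (intro restrict_ext) (simp add: carrier_image inv_image)
  moreover have "lattice_comp L' ?h ?i = lattice_id L'"
    unfolding lattice_comp_def lattice_id_def compose_def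
    by (intro restrict_ext) (simp add: carrier_image inv_into_into f_inv_into_f)
  ultimately show ?thesis
    unfolding lattice_isos_def using restrict_irr_preserving by blast
qed

end


section \<open>Lattices represented by contexts\<close>

text \<open>Together with \<open>inv_gorder\<close> this is the symmetry that turns statements about
  \<open>\<gamma>\<close>, joins and extents into statements about \<open>\<mu>\<close>, meets and
  intents.\<close>

definition dual_context :: "('j, 'm) formal_context \<Rightarrow> ('m, 'j) formal_context" where
  "dual_context K = \<lparr>Objs = Atts K, Atts = Objs K, Inc = (Inc K)\<inverse>\<rparr>"

lemma dual_context_simps [simp]:
  "Objs (dual_context K) = Atts K" "Atts (dual_context K) = Objs K"
  "up (dual_context K) = down K" "down (dual_context K) = up K"
  "extents (dual_context K) = intents K" "intents (dual_context K) = extents K"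
  "is_context (dual_context K) \<longleftrightarrow> is_context K"
  by (auto simp: dual_context_def up_def down_def extents_def intents_def is_context_def fun_eq_iff)

text \<open>
  The instances are a concept lattice over its reduced context, its encoded copy over the same
  context, and a bigenerated lattice over its standard context.
\<close>

locale irreducible_representation = complete_lattice L for L :: "'a gorder" (structure) +
  fixes K :: "('j, 'm) formal_context" and \<gamma> :: "'j \<Rightarrow> 'a" and \<mu> :: "'m \<Rightarrow> 'a"
  assumes context_K: "is_context K"
    and bij_\<gamma>: "bij_betw \<gamma> (Objs K) (join_irreducibles L)"
    and bij_\<mu>: "bij_betw \<mu> (Atts K) (meet_irreducibles L)"
    and join_dense: "join_dense L (join_irreducibles L)"
    and meet_dense: "meet_dense L (meet_irreducibles L)"
    and Inc_iff: "\<lbrakk>j \<in> Objs K; n \<in> Atts K\<rbrakk> \<Longrightarrow> (j, n) \<in> Inc K \<longleftrightarrow> \<gamma> j \<sqsubseteq> \<mu> n"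
begin

text \<open>The extent of \<open>x\<close> when elements of \<open>L\<close> are read as concepts of
  \<open>K\<close>; \<open>above\<close> gives the intent.\<close>

definition below :: "'a \<Rightarrow> 'j set" where
  "below x = {j \<in> Objs K. \<gamma> j \<sqsubseteq> x}"

definition above :: "'a \<Rightarrow> 'm set" where
  "above x = {n \<in> Atts K. x \<sqsubseteq> \<mu> n}"

lemma representation_dual: "irreducible_representation (inv_gorder L) (dual_context K) \<mu> \<gamma>"
proof -
  interpret dual: complete_lattice "inv_gorder L"
    by (rule complete_lattice_dual)
  have "(n, j) \<in> Inc (dual_context K) \<longleftrightarrow> \<gamma> j \<sqsubseteq> \<mu> n" if "j \<in> Objs K" "n \<in> Atts K" for j n
    using Inc_iff that by (simp add: dual_context_def)
  then show ?thesis
    by unfold_locales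
      (simp_all add: join_irreducibles_dual meet_irreducibles_dual complete_lattice_axioms
        context_K bij_\<gamma> bij_\<mu> join_dense meet_dense join_dense_dual meet_dense_dual)
qed

lemma below_dual: "irreducible_representation.below (inv_gorder L) (dual_context K) \<mu> = above"
  by (simp add: irreducible_representation.below_def[OF representation_dual] above_def fun_eq_iff)

lemma above_dual: "irreducible_representation.above (inv_gorder L) (dual_context K) \<gamma> = below"
  by (simp add: irreducible_representation.above_def[OF representation_dual] below_def fun_eq_iff)

lemma bigenerated: "irreducibly_bigenerated L"
  using complete_lattice_axioms join_dense meet_dense by (simp add: irreducibly_bigenerated_def)

lemma \<gamma>_image: "\<gamma> ` Objs K = join_irreducibles L"
  using bij_\<gamma> by (simp add: bij_betw_def)

lemma \<gamma>_closed [simp]: "j \<in> Objs K \<Longrightarrow> \<gamma> j \<in> carrier L"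
  using \<gamma>_image by (auto simp: join_irreducibles_def)

lemma below_closed: "\<gamma> ` below x \<subseteq> carrier L"
  by (auto simp: below_def)

text \<open>Join-density supplies some set of irreducibles with join \<open>x\<close>. Each of them
  lies below \<open>x\<close>, so passing to all irreducibles below \<open>x\<close> enlarges the
  set without exceeding \<open>x\<close>.\<close>

lemma sup_below:
  assumes "x \<in> carrier L"
  shows "\<Squnion>(\<gamma> ` below x) = x"
proof (rule le_antisym)
  show "\<Squnion>(\<gamma> ` below x) \<sqsubseteq> x"
    using assms below_closed by (auto simp: sup_le_iff below_def)
  obtain A where A: "A \<subseteq> join_irreducibles L" "x = \<Squnion>A"
    using join_dense assms by (auto simp: join_dense_def)
  then have "A \<subseteq> carrier L"
    by (auto simp: join_irreducibles_def)
  have "A \<subseteq> \<gamma> ` below x"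
  proof
    fix a
    assume "a \<in> A"
    then obtain j where "j \<in> Objs K" "a = \<gamma> j"
      using A(1) \<gamma>_image by blast
    then show "a \<in> \<gamma> ` below x"
      using sup_upper[OF \<open>A \<subseteq> carrier L\<close> \<open>a \<in> A\<close>] A(2) by (auto simp: below_def)
  qed
  then have "\<Squnion>A \<sqsubseteq> \<Squnion>(\<gamma> ` below x)"
    using \<open>A \<subseteq> carrier L\<close> below_closed by (intro sup_least sup_upper) auto
  then show "x \<sqsubseteq> \<Squnion>(\<gamma> ` below x)"
    by (simp only: A(2)[symmetric])
qed (use assms below_closed in auto)

lemma le_iff_below:
  assumes "x \<in> carrier L" "y \<in> carrier L"
  shows "x \<sqsubseteq> y \<longleftrightarrow> below x \<subseteq> below y"
proof -
  have "x \<sqsubseteq> y \<longleftrightarrow> (\<forall>j\<in>below x. \<gamma> j \<sqsubseteq> y)"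
    using sup_le_iff[OF below_closed, of y x] assms by (simp add: sup_below)
  then show ?thesis
    by (auto simp: below_def)
qed

text \<open>An attribute is shared by all of \<open>A\<close> iff its value under
  \<open>\<mu>\<close> is an upper bound of the \<open>\<gamma>\<close>-values of \<open>A\<close>,
  that is, iff it lies above their join. Thus the derivation operators become joins and meets in
  \<open>L\<close>.\<close>

lemma up_eq_above:
  assumes "A \<subseteq> Objs K"
  shows "up K A = above (\<Squnion>(\<gamma> ` A))"
proof -
  have *: "\<gamma> ` A \<subseteq> carrier L"
    using assms by auto
  have "\<Squnion>(\<gamma> ` A) \<sqsubseteq> \<mu> n \<longleftrightarrow> (\<forall>j\<in>A. (j, n) \<in> Inc K)" if "n \<in> Atts K" for n
    using that assms bij_\<mu> Inc_iff
    by (subst sup_le_iff[OF *]) (auto simp: bij_betw_def meet_irreducibles_def subset_iff)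
  then show ?thesis
    by (auto simp: up_def above_def)
qed

lemma below_subset: "below x \<subseteq> Objs K"
  by (auto simp: below_def)

lemma up_below: "x \<in> carrier L \<Longrightarrow> up K (below x) = above x"
  by (simp add: up_eq_above below_subset sup_below)

lemma \<mu>_image: "\<mu> ` Atts K = meet_irreducibles L"
  using bij_\<mu> by (simp add: bij_betw_def)

lemma \<mu>_closed [simp]: "n \<in> Atts K \<Longrightarrow> \<mu> n \<in> carrier L"
  using \<mu>_image by (auto simp: meet_irreducibles_def)

lemma above_subset: "above x \<subseteq> Atts K"
  by (auto simp: above_def)

lemma inf_above: "x \<in> carrier L \<Longrightarrow> \<Sqinter>(\<mu> ` above x) = x"
  using irreducible_representation.sup_below[OF representation_dual, of x]
  by (simp add: below_dual)

lemma down_eq_below: "B \<subseteq> Atts K \<Longrightarrow> down K B = below (\<Sqinter>(\<mu> ` B))"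
  using irreducible_representation.up_eq_above[OF representation_dual, of B]
  by (simp add: above_dual)

lemma down_above: "x \<in> carrier L \<Longrightarrow> down K (above x) = below x"
  by (simp add: down_eq_below above_subset inf_above)

text \<open>The closure of a set of objects depends only on the join of its
  \<open>\<gamma>\<close>-values: it consists of all objects below that join.\<close>

lemma extents_eq: "extents K = below ` carrier L"
proof (intro equalityI subsetI)
  fix A
  assume "A \<in> extents K"
  then have "A \<subseteq> Objs K" "A = down K (up K A)"
    by (auto simp: extents_def)
  moreover from this have "\<Squnion>(\<gamma> ` A) \<in> carrier L"
    by (intro sup_closed) auto
  ultimately show "A \<in> below ` carrier L"
    by (metis image_eqI up_eq_above down_above)
next
  fix A
  assume "A \<in> below ` carrier L"
  then show "A \<in> extents K"
    using below_subset by (auto simp: extents_def up_below down_above)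
qed

lemma concepts_eq: "concepts K = (\<lambda>x. (below x, above x)) ` carrier L"
proof (intro equalityI subsetI)
  fix c
  assume "c \<in> concepts K"
  then obtain A B where c: "c = (A, B)" "A \<subseteq> Objs K" "A = down K (up K A)" "B = up K A"
    by (auto simp: concepts_def)
  then have "A \<in> extents K"
    by (simp add: extents_def)
  then show "c \<in> (\<lambda>x. (below x, above x)) ` carrier L"
    using c up_below by (auto simp: extents_eq)
next
  fix c
  assume "c \<in> (\<lambda>x. (below x, above x)) ` carrier L"
  then show "c \<in> concepts K"
    using below_subset above_subset by (auto simp: concepts_def up_below down_above)
qed

text \<open>The basic theorem on concept lattices for the irreducible bases. Injectivity holds
  because \<open>x\<close> is recovered as the join of the irreducibles indexed by
  \<open>below x\<close>.\<close>

lemma lattice_iso_concept_lattice: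
  "lattice_iso L (concept_lattice K) (\<lambda>x. (below x, above x))"
proof unfold_locales
  have "inj_on (\<lambda>x. (below x, above x)) (carrier L)"
    by (rule inj_onI) (metis fst_conv sup_below)
  then show "bij_betw (\<lambda>x. (below x, above x)) (carrier L) (carrier (concept_lattice K))"
    by (simp add: bij_betw_def concept_lattice_def concepts_eq)
qed (simp_all add: concept_lattice_def le_iff_below)

lemma obj_concept_eq: "j \<in> Objs K \<Longrightarrow> obj_concept K j = (below (\<gamma> j), above (\<gamma> j))"
  by (simp add: obj_concept_def up_eq_above down_above)

lemma att_concept_eq: "n \<in> Atts K \<Longrightarrow> att_concept K n = (below (\<mu> n), above (\<mu> n))"
  by (simp add: att_concept_def down_eq_below up_below)

text \<open>The context stays fixed while the lattice is replaced by an isomorphic one. This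
  produces the representation of the concept lattice and that of its encoded copy.\<close>

lemma representation_transfer:
  assumes "lattice_iso L L' h" "\<And>j. j \<in> Objs K \<Longrightarrow> \<gamma>' j = h (\<gamma> j)"
    "\<And>n. n \<in> Atts K \<Longrightarrow> \<mu>' n = h (\<mu> n)"
  shows "irreducible_representation L' K \<gamma>' \<mu>'"
proof -
  interpret iso: lattice_iso L L' h
    by (rule assms(1))
  have *: "inj_on h A" if "A \<subseteq> carrier L" for A
    using iso.bij that by (auto simp: bij_betw_def intro: inj_on_subset)
  have "bij_betw h (join_irreducibles L) (join_irreducibles L')"
    using * iso.image_join_irreducibles by (auto simp: bij_betw_def join_irreducibles_def)
  then have "bij_betw (h \<circ> \<gamma>) (Objs K) (join_irreducibles L')"
    using bij_\<gamma> bij_betw_trans by blast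
  then have 1: "bij_betw \<gamma>' (Objs K) (join_irreducibles L')"
    using bij_betw_cong[of "Objs K" \<gamma>' "h \<circ> \<gamma>"] by (simp add: assms(2))
  have "bij_betw h (meet_irreducibles L) (meet_irreducibles L')"
    using * iso.image_meet_irreducibles by (auto simp: bij_betw_def meet_irreducibles_def)
  then have "bij_betw (h \<circ> \<mu>) (Atts K) (meet_irreducibles L')"
    using bij_\<mu> bij_betw_trans by blast
  then have 2: "bij_betw \<mu>' (Atts K) (meet_irreducibles L')"
    using bij_betw_cong[of "Atts K" \<mu>' "h \<circ> \<mu>"] by (simp add: assms(3))
  have "join_dense L' (join_irreducibles L')" "meet_dense L' (meet_irreducibles L')"
    using iso.image_join_dense[OF join_dense] iso.image_meet_dense[OF meet_dense]
    by (simp_all add: iso.image_join_irreducibles iso.image_meet_irreducibles)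
  then show ?thesis
    using 1 2 by unfold_locales (simp_all add: context_K Inc_iff iso.le_iff assms(2,3))
qed

lemma concept_representation:
  "irreducible_representation (concept_lattice K) K (obj_concept K) (att_concept K)"
  by (rule representation_transfer[OF lattice_iso_concept_lattice])
    (simp_all add: obj_concept_eq att_concept_eq)

text \<open>Along the isomorphism with the concept lattice the index maps become the object and
  attribute concepts. Their injectivity is purification, and their images are the irreducibles. In
  particular, standard contexts of bigenerated lattices are reduced.\<close>

lemma reduced: "reduced K"
proof -
  interpret c: irreducible_representation "concept_lattice K" K "obj_concept K" "att_concept K"
    by (rule concept_representation)
  show ?thesis
    unfolding reduced_def purified_def
    using context_K c.bij_\<gamma> c.bij_\<mu> c.\<gamma>_image c.\<mu>_image by (auto simp: bij_betw_def)
qed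

end

lemma standard_representation:
  assumes "irreducibly_bigenerated L"
  shows "irreducible_representation L (standard_context L) (\<lambda>j. j) (\<lambda>n. n)"
proof -
  interpret complete_lattice L
    using assms by (simp add: irreducibly_bigenerated_def)
  show ?thesis
    using assms
    by unfold_locales
      (auto simp: irreducibly_bigenerated_def standard_context_def is_context_def bij_betw_def)
qed

section \<open>Concept lattices of arbitrary contexts\<close>

lemma conceptsE:
  assumes "c \<in> concepts K"
  shows "fst c \<subseteq> Objs K" "snd c \<subseteq> Atts K" "down K (snd c) = fst c" "up K (fst c) = snd c"
  using assms by (auto simp: concepts_def)

lemma le_concept_iff:
  assumes "c \<in> concepts K" "d \<in> concepts K"
  shows "fst c \<subseteq> fst d \<longleftrightarrow> snd d \<subseteq> snd c"
proof
  assume "fst c \<subseteq> fst d"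
  then have "up K (fst d) \<subseteq> up K (fst c)"
    by (auto simp: up_def)
  then show "snd d \<subseteq> snd c"
    by (simp add: conceptsE[OF assms(1)] conceptsE[OF assms(2)])
next
  assume "snd d \<subseteq> snd c"
  then have "down K (snd c) \<subseteq> down K (snd d)"
    by (auto simp: down_def)
  then show "fst c \<subseteq> fst d"
    by (simp add: conceptsE[OF assms(1)] conceptsE[OF assms(2)])
qed

lemma obj_concept_closed: "j \<in> Objs K \<Longrightarrow> obj_concept K j \<in> concepts K"
  by (auto simp: obj_concept_def concepts_def up_def down_def)

lemma att_concept_closed: "n \<in> Atts K \<Longrightarrow> att_concept K n \<in> concepts K"
  by (auto simp: att_concept_def concepts_def up_def down_def)

text \<open>The object concept of \<open>j\<close> is the least concept whose extent contains
  \<open>j\<close>. Hence every concept is the join of the object concepts of its extent, which is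
  used for join-density.\<close>

lemma obj_concept_le_iff:
  assumes "j \<in> Objs K" "c \<in> concepts K"
  shows "fst (obj_concept K j) \<subseteq> fst c \<longleftrightarrow> j \<in> fst c"
proof
  assume "j \<in> fst c"
  then have "snd c \<subseteq> up K {j}"
    using conceptsE(4)[OF assms(2)] by (auto simp: up_def)
  then show "fst (obj_concept K j) \<subseteq> fst c"
    using le_concept_iff[OF obj_concept_closed assms(2)] assms by (simp add: obj_concept_def)
qed (use assms in \<open>auto simp: obj_concept_def up_def down_def\<close>)

lemma le_att_concept_iff:
  assumes "n \<in> Atts K" "c \<in> concepts K"
  shows "fst c \<subseteq> fst (att_concept K n) \<longleftrightarrow> n \<in> snd c"
  using assms conceptsE[OF assms(2)] by (auto simp: att_concept_def up_def down_def)

lemma complete_lattice_concept_lattice: "complete_lattice (concept_lattice K)"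
proof -
  let ?L = "concept_lattice K"
  have L: "carrier ?L = concepts K" "\<And>x y. x .=\<^bsub>?L\<^esub> y \<longleftrightarrow> x = y"
    "\<And>x y. x \<sqsubseteq>\<^bsub>?L\<^esub> y \<longleftrightarrow> fst x \<subseteq> fst y"
    by (simp_all add: concept_lattice_def)
  interpret partial_order ?L
  proof unfold_locales
    fix x y
    assume "x \<sqsubseteq>\<^bsub>?L\<^esub> y" "y \<sqsubseteq>\<^bsub>?L\<^esub> x" "x \<in> carrier ?L" "y \<in> carrier ?L"
    then show "x .=\<^bsub>?L\<^esub> y"
      using conceptsE(4)[of x K] conceptsE(4)[of y K] by (simp add: L prod_eq_iff)
  qed (auto simp: L fun_eq_iff)
  show ?thesis
  proof (rule complete_latticeI)
    fix S
    assume S: "S \<subseteq> carrier ?L"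
    \<comment> \<open>The meet is built from the union of the intents instead of the intersection of
      the extents: for empty \<open>S\<close> this gives \<open>down K {}\<close>, which is
      \<open>Objs K\<close>, the correct greatest extent.\<close>
    let ?A = "\<Union>(fst ` S)" and ?B = "\<Union>(snd ` S)"
    have "?A \<subseteq> Objs K" "?B \<subseteq> Atts K"
      using S conceptsE(1,2)[of _ K] unfolding L by blast+
    have A: "(down K (up K ?A), up K ?A) \<in> concepts K"
      using \<open>?A \<subseteq> Objs K\<close> by (auto simp: concepts_def up_def down_def)
    have B: "(down K ?B, up K (down K ?B)) \<in> concepts K"
      using \<open>?B \<subseteq> Atts K\<close> by (auto simp: concepts_def up_def down_def)
    have "is_lub ?L (down K (up K ?A), up K ?A) S"
    proof (rule least_UpperI[OF _ _ S])
      show "(down K (up K ?A), up K ?A) \<in> carrier ?L"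
        using A by (simp add: L)
      show "c \<sqsubseteq>\<^bsub>?L\<^esub> (down K (up K ?A), up K ?A)" if "c \<in> S" for c
        using that \<open>?A \<subseteq> Objs K\<close> by (auto simp: L up_def down_def)
      fix c
      assume "c \<in> Upper ?L S"
      then have "c \<in> concepts K" "\<And>d. d \<in> S \<Longrightarrow> fst d \<subseteq> fst c"
        using Upper_memD[of c ?L S, OF _ _ S] Upper_closed[of ?L S] unfolding L by blast+
      then have c: "c \<in> concepts K" "?A \<subseteq> fst c"
        by blast+
      then have "snd c \<subseteq> up K ?A"
        using conceptsE(4)[of c K] by (auto simp: up_def)
      then show "(down K (up K ?A), up K ?A) \<sqsubseteq>\<^bsub>?L\<^esub> c"
        using le_concept_iff[OF A c(1)] by (simp add: L)
    qed
    then show "\<exists>s. is_lub ?L s S"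
      by blast
    have "is_glb ?L (down K ?B, up K (down K ?B)) S"
    proof (rule greatest_LowerI[OF _ _ S])
      show "(down K ?B, up K (down K ?B)) \<in> carrier ?L"
        using B by (simp add: L)
      show "(down K ?B, up K (down K ?B)) \<sqsubseteq>\<^bsub>?L\<^esub> c" if "c \<in> S" for c
        using that S conceptsE(3)[of c K] by (auto simp: L down_def)
      fix c
      assume "c \<in> Lower ?L S"
      then have c: "c \<in> concepts K" and "\<And>d. d \<in> S \<Longrightarrow> fst c \<subseteq> fst d"
        using Lower_memD[of c ?L S, OF _ _ S] Lower_closed[of ?L S] unfolding L by blast+
      then have "snd d \<subseteq> snd c" if "d \<in> S" for d
        using that S le_concept_iff[of c K d] unfolding L by blast
      then have "down K (snd c) \<subseteq> down K ?B"
        unfolding down_def by blast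
      then show "c \<sqsubseteq>\<^bsub>?L\<^esub> (down K ?B, up K (down K ?B))"
        using conceptsE(3)[OF c] by (simp add: L)
    qed
    then show "\<exists>i. is_glb ?L i S"
      by blast
  qed
qed

section \<open>Dense sets and irreducible elements\<close>

lemma join_irreducibles_subset:
  assumes "complete_lattice L" "join_dense L D"
  shows "join_irreducibles L \<subseteq> D"
proof
  interpret complete_lattice L
    by (rule assms(1))
  fix x
  assume x: "x \<in> join_irreducibles L"
  then have "x \<in> carrier L"
    by (simp add: join_irreducibles_def)
  then obtain A where A: "A \<subseteq> D" "x = \<Squnion>\<^bsub>L\<^esub>A"
    using assms(2) by (auto simp: join_dense_def)
  then have "A \<subseteq> carrier L"
    using assms(2) by (auto simp: join_dense_def)
  \<comment> \<open>Otherwise every member of \<open>A\<close> would be strictly below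
    \<open>x\<close>, and \<open>A\<close> would decompose \<open>x\<close>.\<close>
  have "x \<in> A"
  proof (rule ccontr)
    assume "x \<notin> A"
    have "y \<sqsubset>\<^bsub>L\<^esub> x" if "y \<in> A" for y
      using sup_upper[OF \<open>A \<subseteq> carrier L\<close> that] A(2) that \<open>x \<notin> A\<close>
      by (auto simp: lless_def eq_is_equal)
    then have "A \<subseteq> {y \<in> carrier L. y \<sqsubset>\<^bsub>L\<^esub> x}"
      using \<open>A \<subseteq> carrier L\<close> by blast
    moreover have "\<not> (\<exists>A\<subseteq>{y \<in> carrier L. y \<sqsubset>\<^bsub>L\<^esub> x}. x = \<Squnion>\<^bsub>L\<^esub>A)"
      using x by (simp add: join_irreducibles_def)
    ultimately show False
      using A(2) by blast
  qed
  then show "x \<in> D"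
    using A(1) by blast
qed

lemma meet_irreducibles_subset:
  assumes "complete_lattice L" "meet_dense L D"
  shows "meet_irreducibles L \<subseteq> D"
  using join_irreducibles_subset[OF complete_lattice.complete_lattice_dual[OF assms(1)]] assms
  by (simp add: join_dense_dual join_irreducibles_dual)

text \<open>An element is the join of \<open>A\<close> as soon as both have the same upper bounds.
  With this criterion no join in the concept lattice has to be computed.\<close>

lemma join_denseI:
  assumes "complete_lattice L" "D \<subseteq> carrier L"
    and "\<And>x. x \<in> carrier L \<Longrightarrow>
      \<exists>A\<subseteq>D. \<forall>z\<in>carrier L. x \<sqsubseteq>\<^bsub>L\<^esub> z \<longleftrightarrow> (\<forall>a\<in>A. a \<sqsubseteq>\<^bsub>L\<^esub> z)"
  shows "join_dense L D"
  unfolding join_dense_def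
proof (intro conjI ballI)
  interpret complete_lattice L
    by (rule assms(1))
  fix x
  assume x: "x \<in> carrier L"
  then obtain A where A: "A \<subseteq> D" "\<forall>z\<in>carrier L. x \<sqsubseteq>\<^bsub>L\<^esub> z \<longleftrightarrow> (\<forall>a\<in>A. a \<sqsubseteq>\<^bsub>L\<^esub> z)"
    using assms(3)[OF x] by blast
  then have "A \<subseteq> carrier L"
    using assms(2) by blast
  then have "x = \<Squnion>\<^bsub>L\<^esub>A"
    using x A(2) by (intro eq_if_same_upper) (simp_all add: sup_le_iff)
  then show "\<exists>A\<subseteq>D. x = \<Squnion>\<^bsub>L\<^esub>A"
    using A(1) by blast
qed (rule assms(2))

lemma meet_denseI:
  assumes "complete_lattice L" "D \<subseteq> carrier L"
    and "\<And>x. x \<in> carrier L \<Longrightarrow>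
      \<exists>A\<subseteq>D. \<forall>z\<in>carrier L. z \<sqsubseteq>\<^bsub>L\<^esub> x \<longleftrightarrow> (\<forall>a\<in>A. z \<sqsubseteq>\<^bsub>L\<^esub> a)"
  shows "meet_dense L D"
  using join_denseI[OF complete_lattice.complete_lattice_dual[OF assms(1)], of D] assms(2,3)
  by (simp add: join_dense_dual)

text \<open>In every context the object concepts are join-dense, so they include all
  join-irreducibles; reducedness supplies the reverse inclusion, and purification makes the indexing
  injective. Attribute concepts behave dually.\<close>

lemma reduced_representation:
  assumes "reduced K"
  shows "irreducible_representation (concept_lattice K) K (obj_concept K) (att_concept K)"
proof -
  let ?L = "concept_lattice K"
  have L: "carrier ?L = concepts K" "\<And>x y. x \<sqsubseteq>\<^bsub>?L\<^esub> y \<longleftrightarrow> fst x \<subseteq> fst y"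
    by (simp_all add: concept_lattice_def)
  interpret complete_lattice ?L
    by (rule complete_lattice_concept_lattice)
  have join: "join_dense ?L (obj_concept K ` Objs K)"
  proof (rule join_denseI[OF complete_lattice_concept_lattice])
    show "obj_concept K ` Objs K \<subseteq> carrier ?L"
      by (auto simp: L obj_concept_closed)
    fix c
    assume "c \<in> carrier ?L"
    then have "fst c \<subseteq> Objs K"
      using conceptsE by (simp add: L)
    then have "c \<sqsubseteq>\<^bsub>?L\<^esub> z \<longleftrightarrow> (\<forall>a\<in>obj_concept K ` fst c. a \<sqsubseteq>\<^bsub>?L\<^esub> z)" if "z \<in> carrier ?L" for z
      using that obj_concept_le_iff[of _ K z] by (auto simp: L)
    then show "\<exists>A\<subseteq>obj_concept K ` Objs K. \<forall>z\<in>carrier ?L. c \<sqsubseteq>\<^bsub>?L\<^esub> z \<longleftrightarrow> (\<forall>a\<in>A. a \<sqsubseteq>\<^bsub>?L\<^esub> z)"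
      using \<open>fst c \<subseteq> Objs K\<close> by (intro exI[of _ "obj_concept K ` fst c"]) blast
  qed
  have meet: "meet_dense ?L (att_concept K ` Atts K)"
  proof (rule meet_denseI[OF complete_lattice_concept_lattice])
    show "att_concept K ` Atts K \<subseteq> carrier ?L"
      by (auto simp: L att_concept_closed)
    fix c
    assume c: "c \<in> carrier ?L"
    then have "snd c \<subseteq> Atts K"
      using conceptsE by (simp add: L)
    then have "z \<sqsubseteq>\<^bsub>?L\<^esub> c \<longleftrightarrow> (\<forall>a\<in>att_concept K ` snd c. z \<sqsubseteq>\<^bsub>?L\<^esub> a)" if "z \<in> carrier ?L" for z
      using that c le_att_concept_iff[of _ K z] le_concept_iff[of z K c] by (auto simp: L)
    then show "\<exists>A\<subseteq>att_concept K ` Atts K. \<forall>z\<in>carrier ?L. z \<sqsubseteq>\<^bsub>?L\<^esub> c \<longleftrightarrow> (\<forall>a\<in>A. z \<sqsubseteq>\<^bsub>?L\<^esub> a)"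
      using \<open>snd c \<subseteq> Atts K\<close> by (intro exI[of _ "att_concept K ` snd c"]) blast
  qed
  have J: "obj_concept K ` Objs K = join_irreducibles ?L"
    using assms join_irreducibles_subset[OF complete_lattice_concept_lattice join]
    by (auto simp: reduced_def)
  have M: "att_concept K ` Atts K = meet_irreducibles ?L"
    using assms meet_irreducibles_subset[OF complete_lattice_concept_lattice meet]
    by (auto simp: reduced_def)
  show ?thesis
  proof unfold_locales
    show "(j, n) \<in> Inc K \<longleftrightarrow> obj_concept K j \<sqsubseteq>\<^bsub>?L\<^esub> att_concept K n" if "j \<in> Objs K" "n \<in> Atts K" for j n
      using obj_concept_le_iff[OF that(1) att_concept_closed[OF that(2)]] that
      by (auto simp: L att_concept_def down_def)
  qed (use assms join meet J M in \<open>auto simp: reduced_def purified_def bij_betw_def\<close>)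
qed


section \<open>Morphisms of represented lattices\<close>

text \<open>The relation behind both functors on arrows: \<open>obj_lift\<close> picks the
  homomorphism belonging to a pair, \<open>standard_restrict\<close> the pair belonging to a
  homomorphism. Only index maps occur in it, so such squares can be pasted across different
  representations.\<close>

definition tracks :: "('j, 'm) formal_context \<Rightarrow> ('j \<Rightarrow> 'a) \<Rightarrow> ('m \<Rightarrow> 'a) \<Rightarrow> ('h \<Rightarrow> 'b) \<Rightarrow> ('n \<Rightarrow> 'b) \<Rightarrow>
    ('j, 'm, 'h, 'n) mapping_pair \<Rightarrow> ('a \<Rightarrow> 'b) \<Rightarrow> bool" where
  "tracks K \<gamma> \<mu> \<gamma>' \<mu>' f \<phi> \<longleftrightarrow>
     (\<forall>j\<in>Objs K. \<phi> (\<gamma> j) = \<gamma>' (fst f j)) \<and> (\<forall>n\<in>Atts K. \<phi> (\<mu> n) = \<mu>' (snd f n))"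

lemma conceptual_morphismsD:
  assumes "f \<in> conceptual_morphisms K K'"
  shows "fst f \<in> Objs K \<rightarrow>\<^sub>E Objs K'" "snd f \<in> Atts K \<rightarrow>\<^sub>E Atts K'"
    "\<And>A. A \<in> extents K' \<Longrightarrow> fst f -` A \<inter> Objs K \<in> extents K"
    "\<And>B. B \<in> intents K' \<Longrightarrow> snd f -` B \<inter> Atts K \<in> intents K"
    "\<And>A B. (A, B) \<in> concepts K \<Longrightarrow> (down K' (snd f ` B), up K' (fst f ` A)) \<in> concepts K'"
  using assms by (auto simp: conceptual_morphisms_def)

lemma irr_preserving_homsD:
  assumes "\<phi> \<in> irr_preserving_homs L L'"
  shows "\<phi> \<in> carrier L \<rightarrow>\<^sub>E carrier L'" "sup_pres L L' \<phi>" "inf_pres L L' \<phi>"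
    "x \<in> join_irreducibles L \<Longrightarrow> \<phi> x \<in> join_irreducibles L'"
    "x \<in> meet_irreducibles L \<Longrightarrow> \<phi> x \<in> meet_irreducibles L'"
  using assms by (auto simp: irr_preserving_homs_def complete_homs_def)

lemma sup_pres_dual:
  assumes "complete_lattice L" "complete_lattice L'"
  shows "sup_pres (inv_gorder L) (inv_gorder L') \<phi> \<longleftrightarrow> inf_pres L L' \<phi>"
  using assms by (simp add: sup_pres_def inf_pres_def complete_lattice.complete_lattice_dual)

lemma (in irreducible_representation) above_inject:
  assumes "x \<in> carrier L" "y \<in> carrier L" "above x = above y"
  shows "x = y"
  using inf_above[OF assms(1)] inf_above[OF assms(2)] assms(3) by argo

locale representation_pair =
  L: irreducible_representation L K \<gamma> \<mu> + L': irreducible_representation L' K' \<gamma>' \<mu>'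
  for L :: "'a gorder" and K :: "('j, 'm) formal_context" and \<gamma> \<mu>
    and L' :: "'b gorder" and K' :: "('h, 'n) formal_context" and \<gamma>' \<mu>'
begin

lemma pair_dual:
  "representation_pair (inv_gorder L) (dual_context K) \<mu> \<gamma> (inv_gorder L') (dual_context K') \<mu>' \<gamma>'"
  by (rule representation_pair.intro) (rule L.representation_dual, rule L'.representation_dual)

text \<open>The hypothesis on \<open>above\<close> forces \<open>\<phi> x\<close> to be the join of
  the elements \<open>\<gamma>' (\<alpha> j)\<close> with \<open>j\<close> in
  \<open>L.below x\<close>. So \<open>\<phi> x\<close> lies below \<open>z\<close> iff
  \<open>L.below x\<close> is contained in the preimage of \<open>L'.below z\<close>. This preimage
  is an extent, say \<open>L.below w\<close>, and the condition becomes that \<open>x\<close> is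
  below \<open>w\<close>.\<close>

lemma sup_pres_lift:
  assumes \<alpha>: "\<alpha> \<in> Objs K \<rightarrow> Objs K'"
    and ext: "\<And>A. A \<in> extents K' \<Longrightarrow> \<alpha> -` A \<inter> Objs K \<in> extents K"
    and \<phi>: "\<And>x. x \<in> carrier L \<Longrightarrow> \<phi> x \<in> carrier L'"
    and above: "\<And>x. x \<in> carrier L \<Longrightarrow> L'.above (\<phi> x) = up K' (\<alpha> ` L.below x)"
  shows "sup_pres L L' \<phi>" "\<And>j. j \<in> Objs K \<Longrightarrow> \<phi> (\<gamma> j) = \<gamma>' (\<alpha> j)"
proof -
  have le: "\<phi> x \<sqsubseteq>\<^bsub>L'\<^esub> z \<longleftrightarrow> (\<forall>j\<in>L.below x. \<gamma>' (\<alpha> j) \<sqsubseteq>\<^bsub>L'\<^esub> z)"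
    if "x \<in> carrier L" "z \<in> carrier L'" for x z
  proof -
    have *: "\<alpha> ` L.below x \<subseteq> Objs K'"
      using \<alpha> L.below_subset[of x] by auto
    then have c: "\<gamma>' ` \<alpha> ` L.below x \<subseteq> carrier L'"
      by auto
    have "L'.above (\<phi> x) = L'.above (\<Squnion>\<^bsub>L'\<^esub>(\<gamma>' ` \<alpha> ` L.below x))"
      by (rule trans[OF above[OF that(1)] L'.up_eq_above[OF *]])
    then have "\<phi> x = \<Squnion>\<^bsub>L'\<^esub>(\<gamma>' ` \<alpha> ` L.below x)"
      by (rule L'.above_inject[OF \<phi>[OF that(1)] L'.sup_closed[OF c]])
    then show ?thesis
      using L'.sup_le_iff[OF c that(2)] by auto
  qed
  \<comment> \<open>The witness \<open>w\<close> is the value at \<open>z\<close> of the upper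
    adjoint of \<open>\<phi>\<close>.\<close>
  have adjoint: "\<exists>w\<in>carrier L. L.below w = \<alpha> -` L'.below z \<inter> Objs K \<and>
      (\<forall>x\<in>carrier L. \<phi> x \<sqsubseteq>\<^bsub>L'\<^esub> z \<longleftrightarrow> x \<sqsubseteq>\<^bsub>L\<^esub> w)" if z: "z \<in> carrier L'" for z
  proof -
    have "\<alpha> -` L'.below z \<inter> Objs K \<in> extents K"
      using z by (intro ext) (simp add: L'.extents_eq)
    then obtain w where w: "w \<in> carrier L" "L.below w = \<alpha> -` L'.below z \<inter> Objs K"
      by (auto simp: L.extents_eq)
    have "\<phi> x \<sqsubseteq>\<^bsub>L'\<^esub> z \<longleftrightarrow> x \<sqsubseteq>\<^bsub>L\<^esub> w" if "x \<in> carrier L" for x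
      using L.below_subset[of x] \<alpha>
      by (auto simp: le[OF that z] L.le_iff_below[OF that w(1)] w(2) L'.below_def subset_iff)
    then show ?thesis
      using w by blast
  qed
  show "sup_pres L L' \<phi>"
    unfolding sup_pres_def
  proof (intro conjI allI impI L.complete_lattice_axioms L'.complete_lattice_axioms)
    fix A
    assume A: "A \<subseteq> carrier L"
    then have A': "\<phi> ` A \<subseteq> carrier L'"
      using \<phi> by auto
    show "\<phi> (\<Squnion>\<^bsub>L\<^esub>A) = \<Squnion>\<^bsub>L'\<^esub>(\<phi> ` A)"
    proof (rule L'.eq_if_same_upper)
      fix z
      assume z: "z \<in> carrier L'"
      obtain w where w: "w \<in> carrier L" "\<And>x. x \<in> carrier L \<Longrightarrow> \<phi> x \<sqsubseteq>\<^bsub>L'\<^esub> z \<longleftrightarrow> x \<sqsubseteq>\<^bsub>L\<^esub> w"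
        using adjoint[OF z] by blast
      show "\<phi> (\<Squnion>\<^bsub>L\<^esub>A) \<sqsubseteq>\<^bsub>L'\<^esub> z \<longleftrightarrow> \<Squnion>\<^bsub>L'\<^esub>(\<phi> ` A) \<sqsubseteq>\<^bsub>L'\<^esub> z"
        using A by (auto simp: w(2) L.sup_le_iff[OF A w(1)] L'.sup_le_iff[OF A' z] subset_iff)
    qed (use A A' \<phi> in auto)
  qed
  \<comment> \<open>By construction \<open>\<phi> (\<gamma> j)\<close> is a join over all objects
    below \<open>\<gamma> j\<close>, not over \<open>j\<close> alone. The adjoint shows that
    \<open>j\<close> alone decides: \<open>\<gamma> j\<close> is below \<open>w\<close> iff
    \<open>\<alpha> j\<close> lies in \<open>L'.below z\<close>.\<close>
  show "\<phi> (\<gamma> j) = \<gamma>' (\<alpha> j)" if j: "j \<in> Objs K" for j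
  proof (rule L'.eq_if_same_upper)
    show "\<phi> (\<gamma> j) \<in> carrier L'" "\<gamma>' (\<alpha> j) \<in> carrier L'"
      using j \<phi> \<alpha> by (auto intro!: L'.\<gamma>_closed)
    fix z
    assume z: "z \<in> carrier L'"
    obtain w where w: "w \<in> carrier L" "L.below w = \<alpha> -` L'.below z \<inter> Objs K"
      "\<And>x. x \<in> carrier L \<Longrightarrow> \<phi> x \<sqsubseteq>\<^bsub>L'\<^esub> z \<longleftrightarrow> x \<sqsubseteq>\<^bsub>L\<^esub> w"
      using adjoint[OF z] by blast
    have "j \<in> L.below w \<longleftrightarrow> \<gamma> j \<sqsubseteq>\<^bsub>L\<^esub> w" "\<alpha> j \<in> L'.below z \<longleftrightarrow> \<gamma>' (\<alpha> j) \<sqsubseteq>\<^bsub>L'\<^esub> z"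
      using j \<alpha> by (auto simp: L.below_def L'.below_def)
    then show "\<phi> (\<gamma> j) \<sqsubseteq>\<^bsub>L'\<^esub> z \<longleftrightarrow> \<gamma>' (\<alpha> j) \<sqsubseteq>\<^bsub>L'\<^esub> z"
      using w j by simp
  qed
qed

lemma inf_pres_lift:
  assumes "\<beta> \<in> Atts K \<rightarrow> Atts K'"
    and "\<And>B. B \<in> intents K' \<Longrightarrow> \<beta> -` B \<inter> Atts K \<in> intents K"
    and "\<And>x. x \<in> carrier L \<Longrightarrow> \<phi> x \<in> carrier L'"
    and "\<And>x. x \<in> carrier L \<Longrightarrow> L'.below (\<phi> x) = down K' (\<beta> ` L.above x)"
  shows "inf_pres L L' \<phi>" "\<And>n. n \<in> Atts K \<Longrightarrow> \<phi> (\<mu> n) = \<mu>' (\<beta> n)"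
  using representation_pair.sup_pres_lift[OF pair_dual, of \<beta> \<phi>] assms
  by (simp_all add: L'.above_dual L.below_dual
      sup_pres_dual[OF L.complete_lattice_axioms L'.complete_lattice_axioms])

text \<open>The concept condition yields one element with both the prescribed extent and the
  prescribed intent. Hence the join argument for the object part and the meet argument for the
  attribute part apply to the same \<open>\<phi>\<close>. The formulas for \<open>below\<close> and
  \<open>above\<close> are exported in order to identify \<open>\<phi>\<close> with the explicit
  lifts.\<close>

lemma lift_exists:
  assumes f: "f \<in> conceptual_morphisms K K'"
  obtains \<phi> where "\<phi> \<in> irr_preserving_homs L L'" "tracks K \<gamma> \<mu> \<gamma>' \<mu>' f \<phi>"
    "\<And>x. x \<in> carrier L \<Longrightarrow> L'.below (\<phi> x) = down K' (snd f ` L.above x)"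
    "\<And>x. x \<in> carrier L \<Longrightarrow> L'.above (\<phi> x) = up K' (fst f ` L.below x)"
proof -
  note f = conceptual_morphismsD[OF f]
  have "\<exists>y\<in>carrier L'. L'.below y = down K' (snd f ` L.above x) \<and> L'.above y = up K' (fst f ` L.below x)"
    if "x \<in> carrier L" for x
  proof -
    have "(L.below x, L.above x) \<in> concepts K"
      using that by (simp add: L.concepts_eq)
    then show ?thesis
      using f(5) by (fastforce simp: L'.concepts_eq)
  qed
  then obtain \<phi>0 where \<phi>0: "\<And>x. x \<in> carrier L \<Longrightarrow> \<phi>0 x \<in> carrier L'"
    "\<And>x. x \<in> carrier L \<Longrightarrow> L'.below (\<phi>0 x) = down K' (snd f ` L.above x)"
    "\<And>x. x \<in> carrier L \<Longrightarrow> L'.above (\<phi>0 x) = up K' (fst f ` L.below x)"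
    by metis
  define \<phi> where "\<phi> = restrict \<phi>0 (carrier L)"
  have \<phi>: "\<And>x. x \<in> carrier L \<Longrightarrow> \<phi> x \<in> carrier L'"
    "\<And>x. x \<in> carrier L \<Longrightarrow> L'.below (\<phi> x) = down K' (snd f ` L.above x)"
    "\<And>x. x \<in> carrier L \<Longrightarrow> L'.above (\<phi> x) = up K' (fst f ` L.below x)"
    by (simp_all add: \<phi>_def \<phi>0)
  have \<alpha>: "fst f \<in> Objs K \<rightarrow> Objs K'" and \<beta>: "snd f \<in> Atts K \<rightarrow> Atts K'"
    using f(1,2) by (auto simp: PiE_def)
  note sup = sup_pres_lift[OF \<alpha> f(3) \<phi>(1,3)] and inf = inf_pres_lift[OF \<beta> f(4) \<phi>(1,2)]
  have "\<phi> ` join_irreducibles L \<subseteq> join_irreducibles L'"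
    using \<alpha> by (auto simp: L.\<gamma>_image[symmetric] L'.\<gamma>_image[symmetric] sup(2))
  moreover have "\<phi> ` meet_irreducibles L \<subseteq> meet_irreducibles L'"
    using \<beta> by (auto simp: L.\<mu>_image[symmetric] L'.\<mu>_image[symmetric] inf(2))
  moreover have "\<phi> \<in> carrier L \<rightarrow>\<^sub>E carrier L'"
    unfolding \<phi>_def using \<phi>0(1) by (intro restrict_PiE_iff[THEN iffD2]) simp
  ultimately have "\<phi> \<in> irr_preserving_homs L L'"
    using sup(1) inf(1) by (simp add: irr_preserving_homs_def complete_homs_def)
  moreover have "tracks K \<gamma> \<mu> \<gamma>' \<mu>' f \<phi>"
    using sup(2) inf(2) by (simp add: tracks_def)
  ultimately show thesis
    using that \<phi>(2,3) by blast
qed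

text \<open>The converse of the adjunction argument: a join-preserving map has an upper adjoint, and
  the preimage of the extent of \<open>z\<close> is the extent of the adjoint's value at
  \<open>z\<close>.\<close>

lemma sup_pres_restrict:
  assumes sup: "sup_pres L L' \<phi>" and \<phi>: "\<And>x. x \<in> carrier L \<Longrightarrow> \<phi> x \<in> carrier L'"
    and \<alpha>: "\<And>j. j \<in> Objs K \<Longrightarrow> \<alpha> j \<in> Objs K'" "\<And>j. j \<in> Objs K \<Longrightarrow> \<phi> (\<gamma> j) = \<gamma>' (\<alpha> j)"
  shows "\<And>A. A \<in> extents K' \<Longrightarrow> \<alpha> -` A \<inter> Objs K \<in> extents K"
    "\<And>x. x \<in> carrier L \<Longrightarrow> up K' (\<alpha> ` L.below x) = L'.above (\<phi> x)"
proof -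
  have sup: "\<phi> (\<Squnion>\<^bsub>L\<^esub>A) = \<Squnion>\<^bsub>L'\<^esub>(\<phi> ` A)" if "A \<subseteq> carrier L" for A
    using sup that by (simp add: sup_pres_def)
  have image: "\<phi> ` \<gamma> ` A = \<gamma>' ` \<alpha> ` A" if "A \<subseteq> Objs K" for A
    unfolding image_image using that \<alpha>(2) by (intro image_cong) auto
  show "up K' (\<alpha> ` L.below x) = L'.above (\<phi> x)" if "x \<in> carrier L" for x
  proof -
    have *: "\<alpha> ` L.below x \<subseteq> Objs K'"
      using \<alpha>(1) L.below_subset[of x] by auto
    have "\<phi> x = \<phi> (\<Squnion>\<^bsub>L\<^esub>(\<gamma> ` L.below x))"
      using that by (simp add: L.sup_below)
    then have "\<phi> x = \<Squnion>\<^bsub>L'\<^esub>(\<gamma>' ` \<alpha> ` L.below x)"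
      by (simp only: sup[OF L.below_closed] image[OF L.below_subset])
    then show ?thesis
      by (simp add: L'.up_eq_above[OF *])
  qed
  fix A
  assume "A \<in> extents K'"
  then obtain z where z: "z \<in> carrier L'" "A = L'.below z"
    by (auto simp: L'.extents_eq)
  define P where "P = \<alpha> -` A \<inter> Objs K"
  have P: "\<gamma> ` P \<subseteq> carrier L" "P \<subseteq> Objs K"
    by (auto simp: P_def)
  \<comment> \<open>The greatest element that \<open>\<phi>\<close> maps below \<open>z\<close>. It
    is mapped below \<open>z\<close> because \<open>\<phi>\<close> preserves this join and all
    objects in \<open>P\<close> are sent below \<open>z\<close>.\<close>
  define w where "w = \<Squnion>\<^bsub>L\<^esub>(\<gamma> ` P)"
  have w: "w \<in> carrier L"
    using P by (simp add: w_def)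
  have "\<phi> w \<sqsubseteq>\<^bsub>L'\<^esub> z"
  proof -
    have "\<gamma>' ` \<alpha> ` P \<subseteq> carrier L'"
      using \<alpha>(1) P(2) by auto
    then have "\<Squnion>\<^bsub>L'\<^esub>(\<gamma>' ` \<alpha> ` P) \<sqsubseteq>\<^bsub>L'\<^esub> z"
      using z by (intro L'.sup_least) (auto simp: P_def L'.below_def)
    then show ?thesis
      by (simp only: w_def sup[OF P(1)] image[OF P(2)])
  qed
  have mono: "\<phi> x \<sqsubseteq>\<^bsub>L'\<^esub> \<phi> y" if "x \<in> carrier L" "y \<in> carrier L" "x \<sqsubseteq>\<^bsub>L\<^esub> y" for x y
  proof -
    have "\<Squnion>\<^bsub>L\<^esub>{x, y} = y"
      using that by (intro L.eq_if_same_upper) (auto simp: L.sup_le_iff intro: L.le_trans)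
    then have "\<phi> y = \<Squnion>\<^bsub>L'\<^esub>{\<phi> x, \<phi> y}"
      using sup[of "{x, y}"] that by simp
    then show ?thesis
      using that \<phi> L'.sup_upper[of "{\<phi> x, \<phi> y}" "\<phi> x"] by simp
  qed
  have "L.below w = P"
  proof (intro equalityI subsetI)
    fix j
    assume "j \<in> L.below w"
    then have j: "j \<in> Objs K" "\<gamma> j \<sqsubseteq>\<^bsub>L\<^esub> w"
      by (simp_all add: L.below_def)
    then have "\<gamma>' (\<alpha> j) \<sqsubseteq>\<^bsub>L'\<^esub> \<phi> w"
      using mono[of "\<gamma> j" w] w \<alpha>(2) by simp
    then have "\<gamma>' (\<alpha> j) \<sqsubseteq>\<^bsub>L'\<^esub> z"
      using \<open>\<phi> w \<sqsubseteq>\<^bsub>L'\<^esub> z\<close> z(1) w \<phi> \<alpha>(1) j(1) by (intro L'.le_trans[of "\<gamma>' (\<alpha> j)" "\<phi> w" z]) auto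
    then show "j \<in> P"
      using j \<alpha>(1) by (simp add: P_def z(2) L'.below_def)
  next
    fix j
    assume "j \<in> P"
    then show "j \<in> L.below w"
      using P L.sup_upper[OF P(1), of "\<gamma> j"] by (auto simp: L.below_def w_def)
  qed
  then show "\<alpha> -` A \<inter> Objs K \<in> extents K"
    using w by (auto simp: L.extents_eq P_def)
qed

lemma inf_pres_restrict:
  assumes "inf_pres L L' \<phi>" "\<And>x. x \<in> carrier L \<Longrightarrow> \<phi> x \<in> carrier L'"
    and "\<And>n. n \<in> Atts K \<Longrightarrow> \<beta> n \<in> Atts K'" "\<And>n. n \<in> Atts K \<Longrightarrow> \<phi> (\<mu> n) = \<mu>' (\<beta> n)"
  shows "\<And>B. B \<in> intents K' \<Longrightarrow> \<beta> -` B \<inter> Atts K \<in> intents K"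
    "\<And>x. x \<in> carrier L \<Longrightarrow> down K' (\<beta> ` L.above x) = L'.below (\<phi> x)"
  using representation_pair.sup_pres_restrict[OF pair_dual, of \<phi> \<beta>] assms
  by (simp_all add: L'.above_dual L.below_dual
      sup_pres_dual[OF L.complete_lattice_axioms L'.complete_lattice_axioms])

text \<open>The concept condition comes for free: the two derived sets are the extent and the intent
  of the single element \<open>\<phi> x\<close>, where \<open>x\<close> is the element with extent
  \<open>A\<close> and intent \<open>B\<close>.\<close>

lemma conceptualI:
  assumes \<phi>: "\<phi> \<in> irr_preserving_homs L L'" and t: "tracks K \<gamma> \<mu> \<gamma>' \<mu>' f \<phi>"
    and \<alpha>: "fst f \<in> Objs K \<rightarrow>\<^sub>E Objs K'" and \<beta>: "snd f \<in> Atts K \<rightarrow>\<^sub>E Atts K'"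
  shows "f \<in> conceptual_morphisms K K'"
proof -
  note \<phi> = irr_preserving_homsD[OF \<phi>]
  have c: "\<phi> x \<in> carrier L'" if "x \<in> carrier L" for x
    using \<phi>(1) that by auto
  have sup: "\<And>A. A \<in> extents K' \<Longrightarrow> fst f -` A \<inter> Objs K \<in> extents K"
    "\<And>x. x \<in> carrier L \<Longrightarrow> up K' (fst f ` L.below x) = L'.above (\<phi> x)"
    using sup_pres_restrict[OF \<phi>(2) c, of "fst f"] t \<alpha> by (auto simp: tracks_def)
  have inf: "\<And>B. B \<in> intents K' \<Longrightarrow> snd f -` B \<inter> Atts K \<in> intents K"
    "\<And>x. x \<in> carrier L \<Longrightarrow> down K' (snd f ` L.above x) = L'.below (\<phi> x)"
    using inf_pres_restrict[OF \<phi>(3) c, of "snd f"] t \<beta> by (auto simp: tracks_def)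
  have "(down K' (snd f ` B), up K' (fst f ` A)) \<in> concepts K'" if "(A, B) \<in> concepts K" for A B
    using that c by (auto simp: L.concepts_eq L'.concepts_eq sup(2) inf(2))
  then show ?thesis
    using \<alpha> \<beta> sup(1) inf(1) by (auto simp: conceptual_morphisms_def split_beta)
qed

text \<open>Preservation of irreducibles says exactly that \<open>\<phi> (\<gamma> j)\<close> and
  \<open>\<phi> (\<mu> n)\<close> are again indexed by an object and an attribute of
  \<open>K'\<close>.\<close>

lemma restriction_exists:
  assumes "\<phi> \<in> irr_preserving_homs L L'"
  obtains f where "f \<in> conceptual_morphisms K K'" "tracks K \<gamma> \<mu> \<gamma>' \<mu>' f \<phi>"
proof -
  note \<phi> = irr_preserving_homsD[OF assms]
  have "\<exists>h\<in>Objs K'. \<phi> (\<gamma> j) = \<gamma>' h" if "j \<in> Objs K" for j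
    using \<phi>(4)[of "\<gamma> j"] that by (auto simp: L.\<gamma>_image[symmetric] L'.\<gamma>_image[symmetric])
  then obtain \<alpha> where \<alpha>: "\<And>j. j \<in> Objs K \<Longrightarrow> \<alpha> j \<in> Objs K' \<and> \<phi> (\<gamma> j) = \<gamma>' (\<alpha> j)"
    by metis
  have "\<exists>h\<in>Atts K'. \<phi> (\<mu> n) = \<mu>' h" if "n \<in> Atts K" for n
    using \<phi>(5)[of "\<mu> n"] that by (auto simp: L.\<mu>_image[symmetric] L'.\<mu>_image[symmetric])
  then obtain \<beta> where \<beta>: "\<And>n. n \<in> Atts K \<Longrightarrow> \<beta> n \<in> Atts K' \<and> \<phi> (\<mu> n) = \<mu>' (\<beta> n)"
    by metis
  let ?f = "(restrict \<alpha> (Objs K), restrict \<beta> (Atts K))"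
  have "tracks K \<gamma> \<mu> \<gamma>' \<mu>' ?f \<phi>"
    using \<alpha> \<beta> by (simp add: tracks_def)
  moreover from this have "?f \<in> conceptual_morphisms K K'"
    using \<alpha> \<beta> by (intro conceptualI[OF assms]) auto
  ultimately show thesis
    using that by blast
qed

text \<open>Both maps preserve joins and agree on a join-dense set. Later equations between
  homomorphisms are obtained by showing that one pair tracks both sides.\<close>

lemma hom_unique:
  assumes "\<phi> \<in> irr_preserving_homs L L'" "\<psi> \<in> irr_preserving_homs L L'"
    and "tracks K \<gamma> \<mu> \<gamma>' \<mu>' f \<phi>" "tracks K \<gamma> \<mu> \<gamma>' \<mu>' f \<psi>"
  shows "\<phi> = \<psi>"
proof -
  note \<phi> = irr_preserving_homsD[OF assms(1)] and \<psi> = irr_preserving_homsD[OF assms(2)]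
  show ?thesis
  proof (rule PiE_ext[OF \<phi>(1) \<psi>(1)])
    fix x
    assume x: "x \<in> carrier L"
    have "\<phi> ` \<gamma> ` L.below x = \<psi> ` \<gamma> ` L.below x"
      using assms(3,4) L.below_subset[of x] unfolding image_image
      by (intro image_cong) (auto simp: tracks_def)
    then have "\<phi> (\<Squnion>\<^bsub>L\<^esub>(\<gamma> ` L.below x)) = \<psi> (\<Squnion>\<^bsub>L\<^esub>(\<gamma> ` L.below x))"
      using \<phi>(2) \<psi>(2) L.below_closed[of x] by (simp add: sup_pres_def)
    then show "\<phi> x = \<psi> x"
      using x by (simp add: L.sup_below)
  qed
qed

text \<open>The index maps of the target are injective. Only the types of \<open>f\<close> and
  \<open>g\<close> are demanded, so composites can be compared before they are known to be
  conceptual.\<close>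

lemma mapping_pair_unique:
  assumes "fst f \<in> Objs K \<rightarrow>\<^sub>E Objs K'" "snd f \<in> Atts K \<rightarrow>\<^sub>E Atts K'"
    and "fst g \<in> Objs K \<rightarrow>\<^sub>E Objs K'" "snd g \<in> Atts K \<rightarrow>\<^sub>E Atts K'"
    and "tracks K \<gamma> \<mu> \<gamma>' \<mu>' f \<phi>" "tracks K \<gamma> \<mu> \<gamma>' \<mu>' g \<phi>"
  shows "f = g"
proof (rule prod_eqI)
  show "fst f = fst g"
  proof (rule PiE_ext[OF assms(1,3)])
    fix j
    assume j: "j \<in> Objs K"
    then have "\<gamma>' (fst f j) = \<gamma>' (fst g j)"
      using assms(5,6) unfolding tracks_def by metis
    then show "fst f j = fst g j"
      using L'.bij_\<gamma> assms(1,3) j by (auto simp: bij_betw_def inj_on_def)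
  qed
  show "snd f = snd g"
  proof (rule PiE_ext[OF assms(2,4)])
    fix n
    assume n: "n \<in> Atts K"
    then have "\<mu>' (snd f n) = \<mu>' (snd g n)"
      using assms(5,6) unfolding tracks_def by metis
    then show "snd f n = snd g n"
      using L'.bij_\<mu> assms(2,4) n by (auto simp: bij_betw_def inj_on_def)
  qed
qed

end


section \<open>Composition\<close>

text \<open>Pasting of commuting squares. The representation places the indexed irreducibles in the
  carrier, where \<open>lattice_comp\<close> is ordinary composition.\<close>

lemma tracks_comp:
  assumes "irreducible_representation L K \<gamma> \<mu>" "fst f \<in> Objs K \<rightarrow>\<^sub>E Objs K'" "snd f \<in> Atts K \<rightarrow>\<^sub>E Atts K'"
    and "tracks K \<gamma> \<mu> \<gamma>' \<mu>' f \<phi>" "tracks K' \<gamma>' \<mu>' \<gamma>'' \<mu>'' g \<psi>"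
  shows "tracks K \<gamma> \<mu> \<gamma>'' \<mu>'' (context_comp K g f) (lattice_comp L \<psi> \<phi>)"
proof -
  interpret irreducible_representation L K \<gamma> \<mu>
    by (rule assms(1))
  show ?thesis
    using PiE_mem[OF assms(2)] PiE_mem[OF assms(3)] assms(4,5)
    by (simp add: tracks_def context_comp_def lattice_comp_def compose_eq)
qed

lemma tracks_id:
  assumes "irreducible_representation L K \<gamma> \<mu>"
  shows "tracks K \<gamma> \<mu> \<gamma> \<mu> (context_id K) (lattice_id L)"
proof -
  interpret irreducible_representation L K \<gamma> \<mu>
    by (rule assms)
  show ?thesis
    by (simp add: tracks_def context_id_def lattice_id_def)
qed

lemma lattice_id_irr_preserving:
  assumes "complete_lattice L"
  shows "lattice_id L \<in> irr_preserving_homs L L"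
proof -
  interpret complete_lattice L
    by (rule assms)
  interpret lattice_iso L L id
    by unfold_locales (simp_all add: eq_is_equal)
  show ?thesis
    using restrict_irr_preserving by (simp add: lattice_id_def)
qed

lemma lattice_comp_irr_preserving:
  assumes \<phi>: "\<phi> \<in> irr_preserving_homs L L'" and \<psi>: "\<psi> \<in> irr_preserving_homs L' L''"
  shows "lattice_comp L \<psi> \<phi> \<in> irr_preserving_homs L L''"
proof -
  note \<phi>' = irr_preserving_homsD[OF \<phi>] and \<psi>' = irr_preserving_homsD[OF \<psi>]
  interpret L: complete_lattice L
    using \<phi>'(2) by (simp add: sup_pres_def)
  have cl: "complete_lattice L''"
    using \<psi>'(2) by (simp add: sup_pres_def)
  have comp: "lattice_comp L \<psi> \<phi> x = \<psi> (\<phi> x)" if "x \<in> carrier L" for x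
    using that by (simp add: lattice_comp_def compose_eq)
  have image: "lattice_comp L \<psi> \<phi> ` A = \<psi> ` \<phi> ` A" "\<phi> ` A \<subseteq> carrier L'" if "A \<subseteq> carrier L" for A
  proof -
    show "lattice_comp L \<psi> \<phi> ` A = \<psi> ` \<phi> ` A"
      unfolding image_image using comp that by (intro image_cong) auto
    show "\<phi> ` A \<subseteq> carrier L'"
      using PiE_mem[OF \<phi>'(1)] that by blast
  qed
  have "sup_pres L L'' (lattice_comp L \<psi> \<phi>)"
    unfolding sup_pres_def
  proof (intro conjI allI impI L.complete_lattice_axioms cl)
    fix A
    assume A: "A \<subseteq> carrier L"
    have "\<psi> (\<phi> (\<Squnion>\<^bsub>L\<^esub>A)) = \<Squnion>\<^bsub>L''\<^esub>(\<psi> ` \<phi> ` A)"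
      using \<phi>'(2) \<psi>'(2) A image(2)[OF A] unfolding sup_pres_def by metis
    then show "lattice_comp L \<psi> \<phi> (\<Squnion>\<^bsub>L\<^esub>A) = \<Squnion>\<^bsub>L''\<^esub>(lattice_comp L \<psi> \<phi> ` A)"
      by (simp only: image(1)[OF A] comp[OF L.sup_closed[OF A]])
  qed
  moreover have "inf_pres L L'' (lattice_comp L \<psi> \<phi>)"
    unfolding inf_pres_def
  proof (intro conjI allI impI L.complete_lattice_axioms cl)
    fix A
    assume A: "A \<subseteq> carrier L"
    have "\<psi> (\<phi> (\<Sqinter>\<^bsub>L\<^esub>A)) = \<Sqinter>\<^bsub>L''\<^esub>(\<psi> ` \<phi> ` A)"
      using \<phi>'(3) \<psi>'(3) A image(2)[OF A] unfolding inf_pres_def by metis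
    then show "lattice_comp L \<psi> \<phi> (\<Sqinter>\<^bsub>L\<^esub>A) = \<Sqinter>\<^bsub>L''\<^esub>(lattice_comp L \<psi> \<phi> ` A)"
      by (simp only: image(1)[OF A] comp[OF L.inf_closed[OF A]])
  qed
  moreover have "lattice_comp L \<psi> \<phi> \<in> carrier L \<rightarrow>\<^sub>E carrier L''"
    using PiE_mem[OF \<phi>'(1)] PiE_mem[OF \<psi>'(1)]
    by (auto simp: lattice_comp_def compose_def)
  moreover have "lattice_comp L \<psi> \<phi> x \<in> join_irreducibles L''" if "x \<in> join_irreducibles L" for x
    using that comp[of x] \<psi>'(4)[OF \<phi>'(4)[OF that]] by (simp add: join_irreducibles_def)
  moreover have "lattice_comp L \<psi> \<phi> x \<in> meet_irreducibles L''" if "x \<in> meet_irreducibles L" for x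
    using that comp[of x] \<psi>'(5)[OF \<phi>'(5)[OF that]] by (simp add: meet_irreducibles_def)
  ultimately show ?thesis
    by (auto simp: irr_preserving_homs_def complete_homs_def)
qed

lemma context_comp_PiE:
  assumes "fst f \<in> Objs K \<rightarrow>\<^sub>E Objs K'" "snd f \<in> Atts K \<rightarrow>\<^sub>E Atts K'"
    and "fst g \<in> Objs K' \<rightarrow>\<^sub>E Objs K''" "snd g \<in> Atts K' \<rightarrow>\<^sub>E Atts K''"
  shows "fst (context_comp K g f) \<in> Objs K \<rightarrow>\<^sub>E Objs K''"
    "snd (context_comp K g f) \<in> Atts K \<rightarrow>\<^sub>E Atts K''"
  using PiE_mem[OF assms(1)] PiE_mem[OF assms(2)] PiE_mem[OF assms(3)] PiE_mem[OF assms(4)]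
  by (auto simp: context_comp_def compose_def)

lemma context_id_PiE:
  "fst (context_id K) \<in> Objs K \<rightarrow>\<^sub>E Objs K" "snd (context_id K) \<in> Atts K \<rightarrow>\<^sub>E Atts K"
  by (auto simp: context_id_def)

lemma context_id_conceptual:
  assumes "irreducible_representation L K \<gamma> \<mu>"
  shows "context_id K \<in> conceptual_morphisms K K"
proof -
  interpret irreducible_representation L K \<gamma> \<mu>
    by (rule assms)
  interpret representation_pair L K \<gamma> \<mu> L K \<gamma> \<mu> ..
  show ?thesis
    by (rule conceptualI[OF lattice_id_irr_preserving tracks_id[OF assms] context_id_PiE])
      (rule complete_lattice_axioms)
qed

text \<open>The image of an intent need not be an intent, so the concept condition for
  \<open>g\<close> does not apply to what \<open>f\<close> delivers. Instead both pairs are lifted,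
  the homomorphisms are composed, and the composite pair is conceptual because it tracks the
  result.\<close>

lemma context_comp_conceptual:
  assumes K: "reduced K" and K': "reduced K'" and K'': "reduced K''"
    and f: "f \<in> conceptual_morphisms K K'" and g: "g \<in> conceptual_morphisms K' K''"
  shows "context_comp K g f \<in> conceptual_morphisms K K''"
proof -
  note reps = reduced_representation[OF K] reduced_representation[OF K'] reduced_representation[OF K'']
  note f' = conceptual_morphismsD(1,2)[OF f] and g' = conceptual_morphismsD(1,2)[OF g]
  obtain \<phi> where \<phi>: "\<phi> \<in> irr_preserving_homs (concept_lattice K) (concept_lattice K')"
    "tracks K (obj_concept K) (att_concept K) (obj_concept K') (att_concept K') f \<phi>"
    using representation_pair.lift_exists[OF representation_pair.intro[OF reps(1,2)] f] .
  obtain \<psi> where \<psi>: "\<psi> \<in> irr_preserving_homs (concept_lattice K') (concept_lattice K'')"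
    "tracks K' (obj_concept K') (att_concept K') (obj_concept K'') (att_concept K'') g \<psi>"
    using representation_pair.lift_exists[OF representation_pair.intro[OF reps(2,3)] g] .
  show ?thesis
    by (rule representation_pair.conceptualI[OF representation_pair.intro[OF reps(1,3)]
          lattice_comp_irr_preserving[OF \<phi>(1) \<psi>(1)] tracks_comp[OF reps(1) f' \<phi>(2) \<psi>(2)]
          context_comp_PiE[OF f' g']])
qed

lemma context_comp_id:
  assumes "fst f \<in> Objs K \<rightarrow>\<^sub>E Objs K'" "snd f \<in> Atts K \<rightarrow>\<^sub>E Atts K'"
  shows "context_comp K f (context_id K) = f" "context_comp K (context_id K') f = f"
proof -
  have "compose (Objs K) (fst f) (restrict id (Objs K)) = fst f"
    "compose (Objs K) (restrict id (Objs K')) (fst f) = fst f"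
    "compose (Atts K) (snd f) (restrict id (Atts K)) = snd f"
    "compose (Atts K) (restrict id (Atts K')) (snd f) = snd f"
    using PiE_mem[OF assms(1)] PiE_mem[OF assms(2)] PiE_arb[OF assms(1)] PiE_arb[OF assms(2)]
    by (auto simp: compose_def restrict_def fun_eq_iff)
  then show "context_comp K f (context_id K) = f" "context_comp K (context_id K') f = f"
    by (simp_all add: context_comp_def context_id_def)
qed

lemma context_comp_assoc:
  assumes "fst f \<in> Objs K \<rightarrow>\<^sub>E Objs K'" "snd f \<in> Atts K \<rightarrow>\<^sub>E Atts K'"
  shows "context_comp K (context_comp K' h g) f = context_comp K h (context_comp K g f)"
  using PiE_mem[OF assms(1)] PiE_mem[OF assms(2)]
  by (auto simp: context_comp_def compose_def restrict_def fun_eq_iff)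

lemma lattice_comp_id:
  assumes "\<phi> \<in> carrier L \<rightarrow>\<^sub>E carrier L'"
  shows "lattice_comp L \<phi> (lattice_id L) = \<phi>" "lattice_comp L (lattice_id L') \<phi> = \<phi>"
  using PiE_mem[OF assms] PiE_arb[OF assms]
  by (auto simp: lattice_comp_def lattice_id_def compose_def restrict_def fun_eq_iff)

lemma lattice_comp_assoc:
  assumes "\<phi> \<in> carrier L \<rightarrow>\<^sub>E carrier L'"
  shows "lattice_comp L (lattice_comp L' \<chi> \<psi>) \<phi> = lattice_comp L \<chi> (lattice_comp L \<psi> \<phi>)"
  using PiE_mem[OF assms]
  by (auto simp: lattice_comp_def compose_def restrict_def fun_eq_iff)


section \<open>Isomorphisms\<close>

text \<open>Two contexts represent the same lattice. Restricting its identity in the other direction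
  gives the inverse, since both composites track the identity and are therefore identities.\<close>

lemma context_iso_if_tracks_id:
  assumes K: "irreducible_representation L K \<gamma> \<mu>" and K': "irreducible_representation L K' \<gamma>' \<mu>'"
    and f: "fst f \<in> Objs K \<rightarrow>\<^sub>E Objs K'" "snd f \<in> Atts K \<rightarrow>\<^sub>E Atts K'"
    and t: "tracks K \<gamma> \<mu> \<gamma>' \<mu>' f (lattice_id L)"
  shows "f \<in> context_isos K K'"
proof -
  interpret irreducible_representation L K \<gamma> \<mu>
    by (rule K)
  have id: "lattice_id L \<in> irr_preserving_homs L L"
    by (rule lattice_id_irr_preserving) (rule complete_lattice_axioms)
  note id_id = lattice_comp_id(1)[OF irr_preserving_homsD(1)[OF id]]
  obtain g where g: "g \<in> conceptual_morphisms K' K" "tracks K' \<gamma>' \<mu>' \<gamma> \<mu> g (lattice_id L)"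
    using representation_pair.restriction_exists[OF representation_pair.intro[OF K' K] id] .
  note g' = conceptual_morphismsD(1,2)[OF g(1)]
  have "context_comp K g f = context_id K"
    using representation_pair.mapping_pair_unique[OF representation_pair.intro[OF K K]
        context_comp_PiE[OF f g'] context_id_PiE _ tracks_id[OF K]]
      tracks_comp[OF K f t g(2)] by (simp add: id_id)
  moreover have "context_comp K' f g = context_id K'"
    using representation_pair.mapping_pair_unique[OF representation_pair.intro[OF K' K']
        context_comp_PiE[OF g' f] context_id_PiE _ tracks_id[OF K']]
      tracks_comp[OF K' g' g(2) t] by (simp add: id_id)
  moreover have "f \<in> conceptual_morphisms K K'"
    by (rule representation_pair.conceptualI[OF representation_pair.intro[OF K K'] id t f])
  ultimately show ?thesis
    using g(1) by (auto simp: context_isos_def)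
qed

text \<open>The same argument with the roles exchanged: two lattices over one context, the inverse
  being a lift of the identity pair.\<close>

lemma lattice_iso_if_tracks_id:
  assumes L: "irreducible_representation L K \<gamma> \<mu>" and L': "irreducible_representation L' K \<gamma>' \<mu>'"
    and \<phi>: "\<phi> \<in> irr_preserving_homs L L'" and t: "tracks K \<gamma> \<mu> \<gamma>' \<mu>' (context_id K) \<phi>"
  shows "\<phi> \<in> lattice_isos L L'"
proof -
  interpret L: irreducible_representation L K \<gamma> \<mu>
    by (rule L)
  interpret L': irreducible_representation L' K \<gamma>' \<mu>'
    by (rule L')
  obtain \<psi> where \<psi>: "\<psi> \<in> irr_preserving_homs L' L" "tracks K \<gamma>' \<mu>' \<gamma> \<mu> (context_id K) \<psi>"
    using representation_pair.lift_exists[OF representation_pair.intro[OF L' L]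
        context_id_conceptual[OF L]] .
  note id_id = context_comp_id(1)[OF context_id_PiE]
  have "lattice_comp L \<psi> \<phi> = lattice_id L"
    using representation_pair.hom_unique[OF representation_pair.intro[OF L L]
        lattice_comp_irr_preserving[OF \<phi> \<psi>(1)]
        lattice_id_irr_preserving[OF L.complete_lattice_axioms] _ tracks_id[OF L]]
      tracks_comp[OF L context_id_PiE t \<psi>(2)] by (simp add: id_id)
  moreover have "lattice_comp L' \<phi> \<psi> = lattice_id L'"
    using representation_pair.hom_unique[OF representation_pair.intro[OF L' L']
        lattice_comp_irr_preserving[OF \<psi>(1) \<phi>]
        lattice_id_irr_preserving[OF L'.complete_lattice_axioms] _ tracks_id[OF L']]
      tracks_comp[OF L' context_id_PiE \<psi>(2) t] by (simp add: id_id)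
  ultimately show ?thesis
    using \<phi> \<psi>(1) by (auto simp: lattice_isos_def)
qed

text \<open>Generalizes \<open>context_unit\<close> to an arbitrary representation, in order to
  cover the encoded concept lattice as well as the plain one.\<close>

definition representation_unit ::
    "('j, 'm) formal_context \<Rightarrow> ('j \<Rightarrow> 'a) \<Rightarrow> ('m \<Rightarrow> 'a) \<Rightarrow> ('j, 'm, 'a, 'a) mapping_pair" where
  "representation_unit K \<gamma> \<mu> = (restrict \<gamma> (Objs K), restrict \<mu> (Atts K))"

lemma standard_context_simps [simp]:
  "Objs (standard_context L) = join_irreducibles L" "Atts (standard_context L) = meet_irreducibles L"
  by (simp_all add: standard_context_def)

text \<open>Both \<open>K\<close> and the standard context represent \<open>L\<close>, and the index
  maps form the pair that tracks the identity of \<open>L\<close>.\<close>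

lemma representation_unit_iso:
  assumes "irreducible_representation L K \<gamma> \<mu>"
  shows "representation_unit K \<gamma> \<mu> \<in> context_isos K (standard_context L)"
proof -
  interpret irreducible_representation L K \<gamma> \<mu>
    by (rule assms)
  show ?thesis
  proof (rule context_iso_if_tracks_id[OF assms standard_representation[OF bigenerated]])
    show "tracks K \<gamma> \<mu> (\<lambda>j. j) (\<lambda>n. n) (representation_unit K \<gamma> \<mu>) (lattice_id L)"
      by (simp add: tracks_def representation_unit_def lattice_id_def)
  qed (auto simp: representation_unit_def \<gamma>_image[symmetric] \<mu>_image[symmetric])
qed

section \<open>The standard context functor on arrows\<close>

lemma standard_restrict_PiE:
  assumes "\<phi> \<in> irr_preserving_homs L L'"
  shows "fst (standard_restrict L \<phi>) \<in> Objs (standard_context L) \<rightarrow>\<^sub>E Objs (standard_context L')"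
    "snd (standard_restrict L \<phi>) \<in> Atts (standard_context L) \<rightarrow>\<^sub>E Atts (standard_context L')"
  using irr_preserving_homsD(4,5)[OF assms] by (auto simp: standard_restrict_def)

lemma standard_restrict_tracks:
  "tracks (standard_context L) (\<lambda>j. j) (\<lambda>n. n) (\<lambda>j. j) (\<lambda>n. n) (standard_restrict L \<phi>) \<phi>"
  by (simp add: tracks_def standard_restrict_def)

lemma standard_restrict_conceptual:
  assumes "irreducibly_bigenerated L" "irreducibly_bigenerated L'" "\<phi> \<in> irr_preserving_homs L L'"
  shows "standard_restrict L \<phi> \<in> conceptual_morphisms (standard_context L) (standard_context L')"
  by (rule representation_pair.conceptualI[OF representation_pair.intro[OF
        assms(1,2)[THEN standard_representation]] assms(3) standard_restrict_tracks
        standard_restrict_PiE[OF assms(3)]])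

lemma standard_restrict_id: "standard_restrict L (lattice_id L) = context_id (standard_context L)"
  by (auto simp: standard_restrict_def lattice_id_def context_id_def restrict_def fun_eq_iff
      join_irreducibles_def meet_irreducibles_def)

lemma standard_restrict_comp:
  assumes "\<phi> \<in> irr_preserving_homs L L'"
  shows "standard_restrict L (lattice_comp L \<psi> \<phi>) =
    context_comp (standard_context L) (standard_restrict L' \<psi>) (standard_restrict L \<phi>)"
proof -
  have "x \<in> carrier L" if "x \<in> join_irreducibles L \<or> x \<in> meet_irreducibles L" for x
    using that by (auto simp: join_irreducibles_def meet_irreducibles_def)
  then show ?thesis
    using irr_preserving_homsD(4,5)[OF assms]
    by (auto simp: standard_restrict_def lattice_comp_def context_comp_def compose_def restrict_def
        fun_eq_iff)
qed

text \<open>Naturality is the tracking relation itself: on an object \<open>j\<close> the two sides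
  are \<open>\<gamma>' (fst f j)\<close> and \<open>\<phi> (\<gamma> j)\<close>, and likewise on
  attributes.\<close>

lemma representation_unit_natural:
  assumes "irreducible_representation L K \<gamma> \<mu>"
    and "fst f \<in> Objs K \<rightarrow>\<^sub>E Objs K'" "snd f \<in> Atts K \<rightarrow>\<^sub>E Atts K'" "tracks K \<gamma> \<mu> \<gamma>' \<mu>' f \<phi>"
  shows "context_comp K (representation_unit K' \<gamma>' \<mu>') f =
    context_comp K (standard_restrict L \<phi>) (representation_unit K \<gamma> \<mu>)"
proof -
  interpret irreducible_representation L K \<gamma> \<mu>
    by (rule assms(1))
  have "\<gamma> j \<in> join_irreducibles L" if "j \<in> Objs K" for j
    using that by (auto simp: \<gamma>_image[symmetric])
  moreover have "\<mu> n \<in> meet_irreducibles L" if "n \<in> Atts K" for n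
    using that by (auto simp: \<mu>_image[symmetric])
  ultimately show ?thesis
    using PiE_mem[OF assms(2)] PiE_mem[OF assms(3)] assms(4)
    by (simp add: context_comp_def representation_unit_def standard_restrict_def tracks_def
        compose_def cong: restrict_cong)
qed

section \<open>The lift to concept lattices\<close>

text \<open>The abstract lift has concepts as values. One formula fixes its intent and the other its
  extent, and in a concept each component determines the other; so both explicit lifts equal
  it.\<close>

lemma obj_lift:
  assumes K: "reduced K" and K': "reduced K'" and f: "f \<in> conceptual_morphisms K K'"
  shows "obj_lift K K' f \<in> irr_preserving_homs (concept_lattice K) (concept_lattice K')"
    and "tracks K (obj_concept K) (att_concept K) (obj_concept K') (att_concept K') f (obj_lift K K' f)"
    and "obj_lift K K' f = att_lift K K' f"
proof -
  interpret L: irreducible_representation "concept_lattice K" K "obj_concept K" "att_concept K"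
    by (rule reduced_representation[OF K])
  interpret L': irreducible_representation "concept_lattice K'" K' "obj_concept K'" "att_concept K'"
    by (rule reduced_representation[OF K'])
  interpret representation_pair "concept_lattice K" K "obj_concept K" "att_concept K"
    "concept_lattice K'" K' "obj_concept K'" "att_concept K'" ..
  have le: "x \<sqsubseteq>\<^bsub>concept_lattice K\<^esub> y \<longleftrightarrow> fst x \<subseteq> fst y" for x y
    by (simp add: concept_lattice_def)
  have le': "x \<sqsubseteq>\<^bsub>concept_lattice K'\<^esub> y \<longleftrightarrow> fst x \<subseteq> fst y" for x y
    by (simp add: concept_lattice_def)
  \<comment> \<open>In a concept lattice the abstract extent and intent of an element are its two
    components.\<close>
  have below: "L.below c = fst c" "L.above c = snd c" if "c \<in> concepts K" for c
    unfolding L.below_def L.above_def le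
    using obj_concept_le_iff[OF _ that] le_att_concept_iff[OF _ that] conceptsE(1,2)[OF that] by blast+
  have below': "L'.below c = fst c" "L'.above c = snd c" if "c \<in> concepts K'" for c
    unfolding L'.below_def L'.above_def le'
    using obj_concept_le_iff[OF _ that] le_att_concept_iff[OF _ that] conceptsE(1,2)[OF that] by blast+
  have carrier: "carrier (concept_lattice K) = concepts K" "carrier (concept_lattice K') = concepts K'"
    by (simp_all add: concept_lattice_def)
  obtain \<phi> where \<phi>: "\<phi> \<in> irr_preserving_homs (concept_lattice K) (concept_lattice K')"
    "tracks K (obj_concept K) (att_concept K) (obj_concept K') (att_concept K') f \<phi>"
    "\<And>c. c \<in> concepts K \<Longrightarrow> L'.below (\<phi> c) = down K' (snd f ` L.above c)"
    "\<And>c. c \<in> concepts K \<Longrightarrow> L'.above (\<phi> c) = up K' (fst f ` L.below c)"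
    using lift_exists[OF f, unfolded carrier] by metis
  have PiE: "\<phi> \<in> concepts K \<rightarrow>\<^sub>E concepts K'"
    using irr_preserving_homsD(1)[OF \<phi>(1)] by (simp add: carrier)
  have \<phi>_eq: "\<phi> c = (down K' (up K' (fst f ` fst c)), up K' (fst f ` fst c))"
    "\<phi> c = (down K' (snd f ` snd c), up K' (down K' (snd f ` snd c)))" if c: "c \<in> concepts K" for c
  proof -
    have c': "\<phi> c \<in> concepts K'"
      by (rule PiE_mem[OF PiE c])
    have 1: "fst (\<phi> c) = down K' (snd f ` snd c)" "snd (\<phi> c) = up K' (fst f ` fst c)"
      using \<phi>(3,4)[OF c] below[OF c] below'[OF c'] by simp_all
    show "\<phi> c = (down K' (up K' (fst f ` fst c)), up K' (fst f ` fst c))"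
      using conceptsE(3)[OF c'] 1(2) by (simp add: prod_eq_iff)
    show "\<phi> c = (down K' (snd f ` snd c), up K' (down K' (snd f ` snd c)))"
      using conceptsE(4)[OF c'] 1(1) by (simp add: prod_eq_iff)
  qed
  have 1: "obj_lift K K' f = \<phi>"
  proof
    show "obj_lift K K' f c = \<phi> c" for c
      using \<phi>_eq(1)[of c] PiE_arb[OF PiE, of c] by (simp add: obj_lift_def split_beta restrict_def)
  qed
  have 2: "att_lift K K' f = \<phi>"
  proof
    show "att_lift K K' f c = \<phi> c" for c
      using \<phi>_eq(2)[of c] PiE_arb[OF PiE, of c] by (simp add: att_lift_def split_beta restrict_def)
  qed
  show "obj_lift K K' f \<in> irr_preserving_homs (concept_lattice K) (concept_lattice K')"
    "tracks K (obj_concept K) (att_concept K) (obj_concept K') (att_concept K') f (obj_lift K K' f)"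
    using \<phi>(1,2) by (simp_all only: 1)
  show "obj_lift K K' f = att_lift K K' f"
    by (simp only: 1 2)
qed

lemma lattice_unit_eq:
  assumes "irreducibly_bigenerated L"
  shows "lattice_unit L = restrict (\<lambda>x.
    (irreducible_representation.below L (standard_context L) (\<lambda>j. j) x,
     irreducible_representation.above L (standard_context L) (\<lambda>n. n) x)) (carrier L)"
proof -
  interpret irreducible_representation L "standard_context L" "\<lambda>j. j" "\<lambda>n. n"
    by (rule standard_representation[OF assms])
  show ?thesis
    by (simp add: lattice_unit_def below_def above_def)
qed

text \<open>The unit is the isomorphism of \<open>L\<close> with the concept lattice of a
  representing context, here the standard one. It maps each irreducible to its own object or
  attribute concept, so the identity pair tracks it.\<close>

lemma lattice_unit:
  assumes "irreducibly_bigenerated L"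
  shows "lattice_unit L \<in> lattice_isos L (concept_lattice (standard_context L))"
    and "tracks (standard_context L) (\<lambda>j. j) (\<lambda>n. n) (obj_concept (standard_context L))
      (att_concept (standard_context L)) (context_id (standard_context L)) (lattice_unit L)"
proof -
  interpret irreducible_representation L "standard_context L" "\<lambda>j. j" "\<lambda>n. n"
    by (rule standard_representation[OF assms])
  show "lattice_unit L \<in> lattice_isos L (concept_lattice (standard_context L))"
    unfolding lattice_unit_eq[OF assms]
    by (rule lattice_iso.restrict_lattice_iso[OF lattice_iso_concept_lattice])
  show "tracks (standard_context L) (\<lambda>j. j) (\<lambda>n. n) (obj_concept (standard_context L))
      (att_concept (standard_context L)) (context_id (standard_context L)) (lattice_unit L)"
    using \<gamma>_closed \<mu>_closed
    by (simp add: tracks_def context_id_def lattice_unit_eq[OF assms] obj_concept_eq att_concept_eq)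
qed


section \<open>Functoriality and bijectivity of the lift, naturality of the lattice unit\<close>

lemma obj_lift_id:
  assumes "reduced K"
  shows "obj_lift K K (context_id K) = lattice_id (concept_lattice K)"
proof -
  note K = reduced_representation[OF assms]
  note lift = obj_lift[OF assms assms context_id_conceptual[OF K]]
  show ?thesis
    by (rule representation_pair.hom_unique[OF representation_pair.intro[OF K K] lift(1)
          lattice_id_irr_preserving lift(2) tracks_id[OF K]]) (rule complete_lattice_concept_lattice)
qed

lemma obj_lift_comp:
  assumes "reduced K" "reduced K'" "reduced K''"
    and f: "f \<in> conceptual_morphisms K K'" and g: "g \<in> conceptual_morphisms K' K''"
  shows "obj_lift K K'' (context_comp K g f) =
    lattice_comp (concept_lattice K) (obj_lift K' K'' g) (obj_lift K K' f)"
proof -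
  note K = reduced_representation[OF assms(1)] and K'' = reduced_representation[OF assms(3)]
  note lift = obj_lift[OF assms(1,3) context_comp_conceptual[OF assms]]
  note f_lift = obj_lift[OF assms(1,2) f] and g_lift = obj_lift[OF assms(2,3) g]
  show ?thesis
    by (rule representation_pair.hom_unique[OF representation_pair.intro[OF K K''] lift(1)
          lattice_comp_irr_preserving[OF f_lift(1) g_lift(1)] lift(2)
          tracks_comp[OF K conceptual_morphismsD(1,2)[OF f] f_lift(2) g_lift(2)]])
qed

text \<open>Equal lifts are tracked by both pairs, which therefore coincide. Conversely, each
  homomorphism restricts to a pair, whose lift it must be by uniqueness.\<close>

lemma obj_lift_bij:
  assumes K: "reduced K" and K': "reduced K'"
  shows "bij_betw (obj_lift K K') (conceptual_morphisms K K')
    (irr_preserving_homs (concept_lattice K) (concept_lattice K'))"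
proof -
  note lift = obj_lift[OF K K']
  interpret representation_pair "concept_lattice K" K "obj_concept K" "att_concept K"
    "concept_lattice K'" K' "obj_concept K'" "att_concept K'"
    by (rule representation_pair.intro[OF K[THEN reduced_representation] K'[THEN reduced_representation]])
  have "inj_on (obj_lift K K') (conceptual_morphisms K K')"
  proof (rule inj_onI)
    fix f g
    assume f: "f \<in> conceptual_morphisms K K'" and g: "g \<in> conceptual_morphisms K K'"
      and eq: "obj_lift K K' f = obj_lift K K' g"
    show "f = g"
      by (rule mapping_pair_unique[OF conceptual_morphismsD(1,2)[OF f] conceptual_morphismsD(1,2)[OF g]
            lift(2)[OF f, unfolded eq] lift(2)[OF g]])
  qed
  moreover have "\<phi> \<in> obj_lift K K' ` conceptual_morphisms K K'"
    if \<phi>: "\<phi> \<in> irr_preserving_homs (concept_lattice K) (concept_lattice K')" for \<phi>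
  proof -
    obtain f where f: "f \<in> conceptual_morphisms K K'"
      "tracks K (obj_concept K) (att_concept K) (obj_concept K') (att_concept K') f \<phi>"
      using restriction_exists[OF \<phi>] .
    then have "\<phi> = obj_lift K K' f"
      using hom_unique[OF \<phi> lift(1)[OF f(1)] f(2) lift(2)[OF f(1)]] by simp
    then show ?thesis
      using f(1) by blast
  qed
  ultimately show ?thesis
    using lift(1) by (auto simp: bij_betw_def)
qed

text \<open>The units are tracked by identity pairs, so both composites are tracked by
  \<open>standard_restrict L \<phi>\<close> and agree by uniqueness.\<close>

lemma lattice_unit_natural:
  assumes L: "irreducibly_bigenerated L" and L': "irreducibly_bigenerated L'"
    and \<phi>: "\<phi> \<in> irr_preserving_homs L L'"
  shows "lattice_comp L (lattice_unit L') \<phi> =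
    lattice_comp L (obj_lift (standard_context L) (standard_context L') (standard_restrict L \<phi>))
      (lattice_unit L)"
proof -
  note S = standard_representation[OF L] and S' = standard_representation[OF L']
  note C' = irreducible_representation.concept_representation[OF S']
  note red = S[THEN irreducible_representation.reduced] S'[THEN irreducible_representation.reduced]
  note r = standard_restrict_PiE[OF \<phi>]
  note lift = obj_lift[OF red standard_restrict_conceptual[OF L L' \<phi>]]
  have unit: "lattice_unit L \<in> irr_preserving_homs L (concept_lattice (standard_context L))"
    "lattice_unit L' \<in> irr_preserving_homs L' (concept_lattice (standard_context L'))"
    using lattice_unit(1)[OF L] lattice_unit(1)[OF L'] by (simp_all add: lattice_isos_def)
  show ?thesis
  proof (rule representation_pair.hom_unique[OF representation_pair.intro[OF S C']])
    show "tracks (standard_context L) (\<lambda>j. j) (\<lambda>n. n) (obj_concept (standard_context L'))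
        (att_concept (standard_context L')) (standard_restrict L \<phi>)
        (lattice_comp L (lattice_unit L') \<phi>)"
      using tracks_comp[OF S r standard_restrict_tracks lattice_unit(2)[OF L']]
      by (simp only: context_comp_id(2)[OF r])
    show "tracks (standard_context L) (\<lambda>j. j) (\<lambda>n. n) (obj_concept (standard_context L'))
        (att_concept (standard_context L')) (standard_restrict L \<phi>)
        (lattice_comp L (obj_lift (standard_context L) (standard_context L') (standard_restrict L \<phi>))
          (lattice_unit L))"
      using tracks_comp[OF S context_id_PiE lattice_unit(2)[OF L] lift(2)]
      by (simp only: context_comp_id(1)[OF r])
  qed (intro lattice_comp_irr_preserving[OF \<phi> unit(2)] lattice_comp_irr_preserving[OF unit(1) lift(1)])+
qed


section \<open>The equivalence over a universe\<close>

text \<open>The order of the copy is defined by decoding, so injectivity of \<open>enc\<close> on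
  the concepts suffices for an isomorphism.\<close>

lemma encoded_lattice_iso:
  assumes "inj_on enc (concepts K)"
  shows "lattice_iso (concept_lattice K) (encoded_concept_lattice enc K) enc"
proof -
  interpret complete_lattice "concept_lattice K"
    by (rule complete_lattice_concept_lattice)
  have "carrier (concept_lattice K) = concepts K"
    by (simp add: concept_lattice_def)
  then show ?thesis
    using assms
    by unfold_locales (simp_all add: encoded_concept_lattice_def bij_betw_def)
qed

lemma encoded_representation:
  assumes "reduced K" "inj_on enc (concepts K)"
  shows "irreducible_representation (encoded_concept_lattice enc K) K
    (\<lambda>j. enc (obj_concept K j)) (\<lambda>n. enc (att_concept K n))"
  by (rule irreducible_representation.representation_transfer[OF reduced_representation[OF assms(1)]
        encoded_lattice_iso[OF assms(2)]]) simp_all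

lemma on_hom_concept_lattice_functor:
  assumes K: "reduced K" "inj_on enc (concepts K)" and K': "reduced K'" "inj_on enc (concepts K')"
    and f: "f \<in> conceptual_morphisms K K'"
  defines "\<phi> \<equiv> on_hom (concept_lattice_functor enc) K K' f"
  shows "\<phi> \<in> irr_preserving_homs (encoded_concept_lattice enc K) (encoded_concept_lattice enc K')"
    and "tracks K (\<lambda>j. enc (obj_concept K j)) (\<lambda>n. enc (att_concept K n))
      (\<lambda>j. enc (obj_concept K' j)) (\<lambda>n. enc (att_concept K' n)) f \<phi>"
proof -
  let ?E = "encoded_concept_lattice enc K" and ?E' = "encoded_concept_lattice enc K'"
  have carrier: "carrier ?E = enc ` concepts K" "carrier (concept_lattice K) = concepts K"
    "carrier (concept_lattice K') = concepts K'"
    by (simp_all add: concept_lattice_def encoded_concept_lattice_def)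
  note lift = obj_lift[OF K(1) K'(1) f]
  note iso = encoded_lattice_iso[OF K(2)] and iso' = encoded_lattice_iso[OF K'(2)]
  have closed: "obj_lift K K' f c \<in> concepts K'" if "c \<in> concepts K" for c
    using PiE_mem[OF irr_preserving_homsD(1)[OF lift(1)]] that by (simp add: carrier)
  \<comment> \<open>Decode, lift, encode: the three factors are irreducibility preserving, the outer
    two as restricted isomorphisms.\<close>
  have "\<phi> = lattice_comp ?E (restrict enc (carrier (concept_lattice K')))
    (lattice_comp ?E (obj_lift K K' f)
      (restrict (inv_into (carrier (concept_lattice K)) enc) (carrier ?E)))"
    unfolding \<phi>_def concept_lattice_functor_def lattice_comp_def compose_def carrier
    using closed by (auto simp: restrict_def fun_eq_iff inv_into_into)
  then show "\<phi> \<in> irr_preserving_homs ?E ?E'"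
    using lattice_comp_irr_preserving[OF lattice_comp_irr_preserving[OF
          lattice_iso.restrict_irr_preserving[OF lattice_iso.inverse[OF iso]] lift(1)]
        lattice_iso.restrict_irr_preserving[OF iso']]
    by simp
  have "\<phi> (enc c) = enc (obj_lift K K' f c)" if "c \<in> concepts K" for c
    using that K(2) by (simp add: \<phi>_def concept_lattice_functor_def inv_into_f_f)
  then show "tracks K (\<lambda>j. enc (obj_concept K j)) (\<lambda>n. enc (att_concept K n))
      (\<lambda>j. enc (obj_concept K' j)) (\<lambda>n. enc (att_concept K' n)) f \<phi>"
    using lift(2) by (simp add: tracks_def obj_concept_closed att_concept_closed)
qed

section \<open>The two categories over a universe and general facts on functors\<close>

lemma reduced_contexts_simps [simp]:
  "Ob (reduced_contexts small) = {K. reduced K \<and> small (Objs K) \<and> small (Atts K)}"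
  "Hom (reduced_contexts small) = conceptual_morphisms"
  "Id (reduced_contexts small) = context_id"
  "Comp (reduced_contexts small) K K' K'' = context_comp K"
  "isos (reduced_contexts small) K K' = context_isos K K'"
  by (simp_all add: reduced_contexts_def isos_def context_isos_def)

lemma bigenerated_lattices_simps [simp]:
  "Ob (bigenerated_lattices small) = {L. irreducibly_bigenerated L \<and>
     small (join_irreducibles L) \<and> small (meet_irreducibles L)}"
  "Hom (bigenerated_lattices small) = irr_preserving_homs"
  "Id (bigenerated_lattices small) = lattice_id"
  "Comp (bigenerated_lattices small) L L' L'' = lattice_comp L"
  "isos (bigenerated_lattices small) L L' = lattice_isos L L'"
  by (simp_all add: bigenerated_lattices_def isos_def lattice_isos_def)

lemma reduced_contexts_category: "is_category (reduced_contexts small)"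
  unfolding is_category_def reduced_contexts_simps
proof (intro conjI ballI)
  show "context_id K \<in> conceptual_morphisms K K"
    if "K \<in> {K. reduced K \<and> small (Objs K) \<and> small (Atts K)}" for K
    using that by (intro context_id_conceptual[OF reduced_representation]) simp
qed (auto intro: context_comp_conceptual simp: context_comp_id[OF conceptual_morphismsD(1,2)]
    context_comp_assoc[OF conceptual_morphismsD(1,2)])

lemma bigenerated_lattices_category: "is_category (bigenerated_lattices small)"
  unfolding is_category_def bigenerated_lattices_simps
  by (intro conjI ballI) (auto simp: irreducibly_bigenerated_def lattice_id_irr_preserving
    intro: lattice_comp_irr_preserving simp: lattice_comp_id[OF irr_preserving_homsD(1)]
    lattice_comp_assoc[OF irr_preserving_homsD(1)])

lemma functor_comp:
  assumes "is_functor C D F" "is_functor D E G"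
  shows "is_functor C E (comp_functor G F)"
  using assms by (simp add: is_functor_def comp_functor_def)

lemma functor_id: "is_category C \<Longrightarrow> is_functor C C id_functor"
  by (simp add: is_functor_def id_functor_def is_category_def)

context
  fixes small :: "'u set \<Rightarrow> bool" and enc :: "'u set \<times> 'u set \<Rightarrow> 'u"
  assumes universe: "universe small enc"
begin

lemma small_image: "small A \<Longrightarrow> small (f ` A)"
  using universe by (simp add: universe_def)

text \<open>Extents and intents are subsets of the small sets \<open>Objs K\<close> and
  \<open>Atts K\<close>, hence small themselves.\<close>

lemma enc_inj:
  assumes "small (Objs K)" "small (Atts K)"
  shows "inj_on enc (concepts K)"
proof (rule inj_on_subset)
  show "inj_on enc {(A, B). small A \<and> small B}"
    using universe by (simp add: universe_def)
  show "concepts K \<subseteq> {(A, B). small A \<and> small B}"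
    using universe assms by (auto simp: universe_def concepts_def)
qed

lemma is_functor_concept_lattice:
  "is_functor (reduced_contexts small) (bigenerated_lattices small) (concept_lattice_functor enc)"
proof -
  let ?F = "concept_lattice_functor enc"
  have ob: "on_ob ?F = encoded_concept_lattice enc"
    by (simp add: concept_lattice_functor_def)
  note hom = on_hom_concept_lattice_functor
  note rep = encoded_representation
  have "encoded_concept_lattice enc K \<in> Ob (bigenerated_lattices small)"
    if "K \<in> Ob (reduced_contexts small)" for K
  proof -
    have K: "reduced K" "small (Objs K)" "small (Atts K)"
      using that by simp_all
    interpret irreducible_representation "encoded_concept_lattice enc K" K
      "\<lambda>j. enc (obj_concept K j)" "\<lambda>n. enc (att_concept K n)"
      by (rule rep[OF K(1) enc_inj[OF K(2,3)]])
    \<comment> \<open>The irreducibles of the encoded lattice are images of \<open>Objs K\<close>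
      and \<open>Atts K\<close> under the index maps, so closure of smallness under images puts the
      lattice into the universe.\<close>
    show ?thesis
      using bigenerated small_image[OF K(2)] small_image[OF K(3)]
      by (simp add: \<gamma>_image[symmetric] \<mu>_image[symmetric])
  qed
  moreover have "on_hom ?F K K (context_id K) = lattice_id (encoded_concept_lattice enc K)"
    if "K \<in> Ob (reduced_contexts small)" for K
  proof -
    have K: "reduced K" "inj_on enc (concepts K)"
      using that enc_inj by simp_all
    note r = rep[OF K]
    note h = hom[OF K K context_id_conceptual[OF r]]
    interpret irreducible_representation "encoded_concept_lattice enc K" K
      "\<lambda>j. enc (obj_concept K j)" "\<lambda>n. enc (att_concept K n)"
      by (rule r)
    show ?thesis
      by (rule representation_pair.hom_unique[OF representation_pair.intro[OF r r] h(1)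
            lattice_id_irr_preserving h(2) tracks_id[OF r]]) (rule complete_lattice_axioms)
  qed
  moreover have "on_hom ?F K K'' (context_comp K g f) =
      lattice_comp (encoded_concept_lattice enc K) (on_hom ?F K' K'' g) (on_hom ?F K K' f)"
    if "K \<in> Ob (reduced_contexts small)" "K' \<in> Ob (reduced_contexts small)"
      "K'' \<in> Ob (reduced_contexts small)"
      and f: "f \<in> conceptual_morphisms K K'" and g: "g \<in> conceptual_morphisms K' K''" for K K' K'' f g
  proof -
    have K: "reduced K" "inj_on enc (concepts K)" "reduced K'" "inj_on enc (concepts K')"
      "reduced K''" "inj_on enc (concepts K'')"
      using that enc_inj by simp_all
    note r = rep[OF K(1,2)] rep[OF K(5,6)]
    note h = hom[OF K(1,2) K(5,6) context_comp_conceptual[OF K(1,3,5) f g]]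
      and hf = hom[OF K(1,2) K(3,4) f] and hg = hom[OF K(3,4) K(5,6) g]
    show ?thesis
      by (rule representation_pair.hom_unique[OF representation_pair.intro[OF r] h(1)
            lattice_comp_irr_preserving[OF hf(1) hg(1)] h(2)
            tracks_comp[OF r(1) conceptual_morphismsD(1,2)[OF f] hf(2) hg(2)]])
  qed
  moreover have "on_hom ?F K K' f \<in>
      irr_preserving_homs (encoded_concept_lattice enc K) (encoded_concept_lattice enc K')"
    if "K \<in> Ob (reduced_contexts small)" "K' \<in> Ob (reduced_contexts small)"
      "f \<in> conceptual_morphisms K K'" for K K' f
    using that by (intro hom enc_inj) simp_all
  ultimately show ?thesis
    unfolding is_functor_def ob
    using reduced_contexts_category[of small] bigenerated_lattices_category[of small] by simp
qed

lemma is_functor_standard_context: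
  "is_functor (bigenerated_lattices small) (reduced_contexts small) standard_context_functor"
  unfolding is_functor_def
  using reduced_contexts_category[of small] bigenerated_lattices_category[of small]
  by (simp add: irreducible_representation.reduced[OF standard_representation]
      standard_context_functor_def standard_restrict_conceptual standard_restrict_id
      standard_restrict_comp)

lemma concept_lattice_equivalence:
  "equivalence_of_categories (reduced_contexts small) (bigenerated_lattices small)
    (concept_lattice_functor enc) standard_context_functor"
proof -
  let ?C = "reduced_contexts small" and ?D = "bigenerated_lattices small"
  let ?F = "concept_lattice_functor enc"
    and ?G = "standard_context_functor :: (_, _, ('u, 'u) formal_context, _) ftor"
  let ?E = "encoded_concept_lattice enc"
  define oc :: "('u, 'u) formal_context \<Rightarrow> 'u \<Rightarrow> 'u" where "oc = (\<lambda>K j. enc (obj_concept K j))"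
  define ac :: "('u, 'u) formal_context \<Rightarrow> 'u \<Rightarrow> 'u" where "ac = (\<lambda>K n. enc (att_concept K n))"
  note F = is_functor_concept_lattice and G = is_functor_standard_context
  have ob: "on_ob ?F = ?E" "on_ob ?G = standard_context"
    and homG: "on_hom ?G L L' = standard_restrict L" for L L'
    by (simp_all add: concept_lattice_functor_def standard_context_functor_def)
  have rep: "irreducible_representation (?E K) K (oc K) (ac K)" if "K \<in> Ob ?C" for K
    using that unfolding oc_def ac_def by (intro encoded_representation enc_inj) simp_all
  have hom: "on_hom ?F K K' f \<in> irr_preserving_homs (?E K) (?E K')"
    "tracks K (oc K) (ac K) (oc K') (ac K') f (on_hom ?F K K' f)"
    if "K \<in> Ob ?C" "K' \<in> Ob ?C" "f \<in> conceptual_morphisms K K'" for K K' f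
    using that unfolding oc_def ac_def by (intro on_hom_concept_lattice_functor enc_inj; simp)+
  have std: "standard_context L \<in> Ob ?C" if "L \<in> Ob ?D" for L
    using G that by (simp add: is_functor_def ob)
  have "natural_isomorphism ?C ?C id_functor (comp_functor ?G ?F)
    (\<lambda>K. representation_unit K (oc K) (ac K))"
    unfolding natural_isomorphism_def
  proof (intro conjI ballI functor_id functor_comp[OF F G] reduced_contexts_category)
    fix K
    assume "K \<in> Ob ?C"
    then show "representation_unit K (oc K) (ac K) \<in> isos ?C (on_ob id_functor K) (on_ob (comp_functor ?G ?F) K)"
      using representation_unit_iso[OF rep] by (simp add: id_functor_def comp_functor_def ob)
  next
    fix K K' f
    assume K: "K \<in> Ob ?C" "K' \<in> Ob ?C" and "f \<in> Hom ?C K K'"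
    then have f: "f \<in> conceptual_morphisms K K'"
      by simp
    then show "Comp ?C (on_ob id_functor K) (on_ob id_functor K') (on_ob (comp_functor ?G ?F) K')
        (representation_unit K' (oc K') (ac K')) (on_hom id_functor K K' f) =
      Comp ?C (on_ob id_functor K) (on_ob (comp_functor ?G ?F) K) (on_ob (comp_functor ?G ?F) K')
        (on_hom (comp_functor ?G ?F) K K' f) (representation_unit K (oc K) (ac K))"
      using representation_unit_natural[OF rep[OF K(1)] conceptual_morphismsD(1,2)[OF f] hom(2)[OF K f]]
      by (simp add: id_functor_def comp_functor_def ob homG)
  qed
  \<comment> \<open>The counit runs from the encoded concept lattice to \<open>L\<close>, against
    the direction of \<open>lattice_unit\<close>. It is obtained by lifting the identity of the
    standard context, which represents both lattices; being tracked by this identity makes it an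
    isomorphism.\<close>
  moreover have "\<exists>\<epsilon>. \<forall>L\<in>Ob ?D. \<epsilon> L \<in> irr_preserving_homs (?E (standard_context L)) L \<and>
    tracks (standard_context L) (oc (standard_context L)) (ac (standard_context L)) (\<lambda>j. j) (\<lambda>n. n)
      (context_id (standard_context L)) (\<epsilon> L)"
  proof (intro bchoice ballI)
    fix L
    assume L: "L \<in> Ob ?D"
    then have "irreducibly_bigenerated L"
      by simp
    note S = standard_representation[OF this]
    show "\<exists>e. e \<in> irr_preserving_homs (?E (standard_context L)) L \<and>
      tracks (standard_context L) (oc (standard_context L)) (ac (standard_context L)) (\<lambda>j. j) (\<lambda>n. n)
        (context_id (standard_context L)) e"
      using representation_pair.lift_exists[OF representation_pair.intro[OF rep[OF std[OF L]] S]
          context_id_conceptual[OF S]] by metis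
  qed
  then obtain \<epsilon> where \<epsilon>: "\<And>L. L \<in> Ob ?D \<Longrightarrow> \<epsilon> L \<in> irr_preserving_homs (?E (standard_context L)) L"
    "\<And>L. L \<in> Ob ?D \<Longrightarrow> tracks (standard_context L) (oc (standard_context L)) (ac (standard_context L))
      (\<lambda>j. j) (\<lambda>n. n) (context_id (standard_context L)) (\<epsilon> L)"
    by blast
  have "natural_isomorphism ?D ?D (comp_functor ?F ?G) id_functor \<epsilon>"
    unfolding natural_isomorphism_def
  proof (intro conjI ballI functor_id functor_comp[OF G F] bigenerated_lattices_category)
    fix L
    assume L: "L \<in> Ob ?D"
    then have "irreducibly_bigenerated L"
      by simp
    note S = standard_representation[OF this]
    show "\<epsilon> L \<in> isos ?D (on_ob (comp_functor ?F ?G) L) (on_ob id_functor L)"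
      using lattice_iso_if_tracks_id[OF rep[OF std[OF L]] S \<epsilon>[OF L]]
      by (simp add: id_functor_def comp_functor_def ob)
  next
    fix L L' \<phi>
    assume L: "L \<in> Ob ?D" and L': "L' \<in> Ob ?D" and "\<phi> \<in> Hom ?D L L'"
    then have b: "irreducibly_bigenerated L" "irreducibly_bigenerated L'"
      and \<phi>: "\<phi> \<in> irr_preserving_homs L L'"
      by simp_all
    note r = standard_restrict_PiE[OF \<phi>] and R = rep[OF std[OF L]]
    note h = hom[OF std[OF L] std[OF L'] standard_restrict_conceptual[OF b \<phi>]]
    let ?h = "on_hom ?F (standard_context L) (standard_context L') (standard_restrict L \<phi>)"
    \<comment> \<open>Since the counits are tracked by identity pairs, both sides are tracked by
      \<open>standard_restrict L \<phi>\<close>.\<close>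
    have "lattice_comp (?E (standard_context L)) (\<epsilon> L') ?h = lattice_comp (?E (standard_context L)) \<phi> (\<epsilon> L)"
    proof (rule representation_pair.hom_unique[OF representation_pair.intro[OF R
            standard_representation[OF b(2)]]])
      show "tracks (standard_context L) (oc (standard_context L)) (ac (standard_context L))
          (\<lambda>j. j) (\<lambda>n. n) (standard_restrict L \<phi>)
          (lattice_comp (?E (standard_context L)) (\<epsilon> L') ?h)"
        using tracks_comp[OF R r h(2) \<epsilon>(2)[OF L']] by (simp only: context_comp_id(2)[OF r])
      show "tracks (standard_context L) (oc (standard_context L)) (ac (standard_context L))
          (\<lambda>j. j) (\<lambda>n. n) (standard_restrict L \<phi>)
          (lattice_comp (?E (standard_context L)) \<phi> (\<epsilon> L))"
        using tracks_comp[OF R context_id_PiE \<epsilon>(2)[OF L] standard_restrict_tracks[of L \<phi>]]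
        by (simp only: context_comp_id(1)[OF r])
    qed (intro lattice_comp_irr_preserving[OF h(1) \<epsilon>(1)[OF L']] lattice_comp_irr_preserving[OF \<epsilon>(1)[OF L] \<phi>])+
    then show "Comp ?D (on_ob (comp_functor ?F ?G) L) (on_ob (comp_functor ?F ?G) L') (on_ob id_functor L')
        (\<epsilon> L') (on_hom (comp_functor ?F ?G) L L' \<phi>) =
      Comp ?D (on_ob (comp_functor ?F ?G) L) (on_ob id_functor L) (on_ob id_functor L')
        (on_hom id_functor L L' \<phi>) (\<epsilon> L)"
      by (simp add: id_functor_def comp_functor_def homG ob)
  qed
  ultimately show ?thesis
    using F G unfolding equivalence_of_categories_def by blast
qed

end

theorem theorem9p1:
  fixes K :: "('j, 'm) formal_context" and K' :: "('j1, 'm1) formal_context"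
    and K'' :: "('j2, 'm2) formal_context"
    and L :: "'a gorder" and L' :: "'b gorder" and L'' :: "'c gorder"
  shows
    "\<comment> \<open>equivalence of the two categories over an arbitrary universe\<close>
     (\<forall>(small :: 'u set \<Rightarrow> bool) enc. universe small enc \<longrightarrow>
        equivalence_of_categories (reduced_contexts small) (bigenerated_lattices small)
          (concept_lattice_functor enc) standard_context_functor) \<and>
     \<comment> \<open>the same without encoding, across types: the concept lattice functor,\<close>
     (reduced K \<and> reduced K' \<and> reduced K'' \<longrightarrow>
        irreducibly_bigenerated (concept_lattice K) \<and>
        (\<forall>f \<in> conceptual_morphisms K K'.
           obj_lift K K' f = att_lift K K' f \<and>
           obj_lift K K' f \<in> irr_preserving_homs (concept_lattice K) (concept_lattice K')) \<and>
        context_id K \<in> conceptual_morphisms K K \<and>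
        obj_lift K K (context_id K) = lattice_id (concept_lattice K) \<and>
        (\<forall>f \<in> conceptual_morphisms K K'. \<forall>g \<in> conceptual_morphisms K' K''.
           context_comp K g f \<in> conceptual_morphisms K K'' \<and>
           obj_lift K K'' (context_comp K g f) =
           lattice_comp (concept_lattice K) (obj_lift K' K'' g) (obj_lift K K' f))) \<and>
     \<comment> \<open>the standard context functor,\<close>
     (irreducibly_bigenerated L \<and> irreducibly_bigenerated L' \<and> irreducibly_bigenerated L'' \<longrightarrow>
        reduced (standard_context L) \<and>
        (\<forall>\<phi> \<in> irr_preserving_homs L L'.
           standard_restrict L \<phi> \<in> conceptual_morphisms (standard_context L) (standard_context L')) \<and>
        lattice_id L \<in> irr_preserving_homs L L \<and>
        standard_restrict L (lattice_id L) = context_id (standard_context L) \<and>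
        (\<forall>\<phi> \<in> irr_preserving_homs L L'. \<forall>\<psi> \<in> irr_preserving_homs L' L''.
           lattice_comp L \<psi> \<phi> \<in> irr_preserving_homs L L'' \<and>
           standard_restrict L (lattice_comp L \<psi> \<phi>) =
           context_comp (standard_context L) (standard_restrict L' \<psi>) (standard_restrict L \<phi>))) \<and>
     \<comment> \<open>and the natural isomorphisms between their composites and the identities\<close>
     (reduced K \<and> reduced K' \<longrightarrow>
        context_unit K \<in> context_isos K (standard_context (concept_lattice K)) \<and>
        (\<forall>f \<in> conceptual_morphisms K K'.
           context_comp K (context_unit K') f =
           context_comp K
             (standard_restrict (concept_lattice K) (obj_lift K K' f)) (context_unit K))) \<and>
     (irreducibly_bigenerated L \<and> irreducibly_bigenerated L' \<longrightarrow>
        lattice_unit L \<in> lattice_isos L (concept_lattice (standard_context L)) \<and>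
        (\<forall>\<phi> \<in> irr_preserving_homs L L'.
           lattice_comp L (lattice_unit L') \<phi> =
           lattice_comp L
             (obj_lift (standard_context L) (standard_context L') (standard_restrict L \<phi>))
             (lattice_unit L))) \<and>
     \<comment> \<open>the correspondence of morphisms\<close>
     (reduced K \<and> reduced K' \<longrightarrow>
        bij_betw (obj_lift K K') (conceptual_morphisms K K')
          (irr_preserving_homs (concept_lattice K) (concept_lattice K')))"
proof (intro conjI allI impI ballI; (elim conjE)?)
  fix small :: "'u set \<Rightarrow> bool" and enc
  assume "universe small enc"
  then show "equivalence_of_categories (reduced_contexts small) (bigenerated_lattices small)
      (concept_lattice_functor enc) standard_context_functor"
    by (rule concept_lattice_equivalence)
next
  assume K: "reduced K" and K': "reduced K'" and K'': "reduced K''"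
  show "irreducibly_bigenerated (concept_lattice K)"
    by (rule irreducible_representation.bigenerated[OF reduced_representation[OF K]])
  show "context_id K \<in> conceptual_morphisms K K"
    by (rule context_id_conceptual[OF reduced_representation[OF K]])
  show "obj_lift K K (context_id K) = lattice_id (concept_lattice K)"
    by (rule obj_lift_id[OF K])
  fix f
  assume f: "f \<in> conceptual_morphisms K K'"
  show "obj_lift K K' f = att_lift K K' f"
    "obj_lift K K' f \<in> irr_preserving_homs (concept_lattice K) (concept_lattice K')"
    by (rule obj_lift[OF K K' f])+
  fix g
  assume g: "g \<in> conceptual_morphisms K' K''"
  show "context_comp K g f \<in> conceptual_morphisms K K''"
    by (rule context_comp_conceptual[OF K K' K'' f g])
  show "obj_lift K K'' (context_comp K g f) =
      lattice_comp (concept_lattice K) (obj_lift K' K'' g) (obj_lift K K' f)"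
    by (rule obj_lift_comp[OF K K' K'' f g])
next
  assume L: "irreducibly_bigenerated L" and L': "irreducibly_bigenerated L'"
    and L'': "irreducibly_bigenerated L''"
  show "reduced (standard_context L)"
    by (rule irreducible_representation.reduced[OF standard_representation[OF L]])
  show "lattice_id L \<in> irr_preserving_homs L L"
    using L by (intro lattice_id_irr_preserving) (simp add: irreducibly_bigenerated_def)
  show "standard_restrict L (lattice_id L) = context_id (standard_context L)"
    by (rule standard_restrict_id)
  fix \<phi>
  assume \<phi>: "\<phi> \<in> irr_preserving_homs L L'"
  show "standard_restrict L \<phi> \<in> conceptual_morphisms (standard_context L) (standard_context L')"
    by (rule standard_restrict_conceptual[OF L L' \<phi>])
  fix \<psi>
  assume \<psi>: "\<psi> \<in> irr_preserving_homs L' L''"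
  show "lattice_comp L \<psi> \<phi> \<in> irr_preserving_homs L L''"
    by (rule lattice_comp_irr_preserving[OF \<phi> \<psi>])
  show "standard_restrict L (lattice_comp L \<psi> \<phi>) =
      context_comp (standard_context L) (standard_restrict L' \<psi>) (standard_restrict L \<phi>)"
    by (rule standard_restrict_comp[OF \<phi>])
next
  assume K: "reduced K" and K': "reduced K'"
  \<comment> \<open>Identifies the explicit unit with the general one for the representation by
    object and attribute concepts.\<close>
  have unit: "context_unit C = representation_unit C (obj_concept C) (att_concept C)"
    for C :: "('x, 'y) formal_context"
    by (simp add: context_unit_def representation_unit_def)
  show "context_unit K \<in> context_isos K (standard_context (concept_lattice K))"
    unfolding unit by (rule representation_unit_iso[OF reduced_representation[OF K]])
  show "bij_betw (obj_lift K K') (conceptual_morphisms K K')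
      (irr_preserving_homs (concept_lattice K) (concept_lattice K'))"
    by (rule obj_lift_bij[OF K K'])
  fix f
  assume f: "f \<in> conceptual_morphisms K K'"
  show "context_comp K (context_unit K') f =
      context_comp K (standard_restrict (concept_lattice K) (obj_lift K K' f)) (context_unit K)"
    unfolding context_unit_def
    using representation_unit_natural[OF reduced_representation[OF K]
        conceptual_morphismsD(1,2)[OF f] obj_lift(2)[OF K K' f]]
    by (simp only: representation_unit_def)
next
  assume L: "irreducibly_bigenerated L" and L': "irreducibly_bigenerated L'"
  show "lattice_unit L \<in> lattice_isos L (concept_lattice (standard_context L))"
    by (rule lattice_unit(1)[OF L])
  fix \<phi>
  assume "\<phi> \<in> irr_preserving_homs L L'"
  then show "lattice_comp L (lattice_unit L') \<phi> =
      lattice_comp L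
        (obj_lift (standard_context L) (standard_context L') (standard_restrict L \<phi>))
        (lattice_unit L)"
    by (rule lattice_unit_natural[OF L L'])
qed

end
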